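(* Let $N \ge 2$ be an integer and let $1 < p < \infty$, $1 \le q < \infty$, $1 < b < 1 + Nq$. Then the ball-mass Lebesgue space $L^{p,q}_b(\mathbb{R}^N)$, equipped with the norm $$\|u\|_{L^{p,q}_b(\mathbb{R}^N)} = \left(\int_0^\infty \rho^{-b}\, h_u^q(\rho)\, d\rho\right)^{1/pq},$$ is a uniformly convex and uniformly smooth Banach space.
   Context: $B_\rho = \{x \in \mathbb{R}^N : |x| < \rho\}$. For a measurable function $u : \mathbb{R}^N \to \mathbb{R}$, $h_u(\rho) = \int_{B_\rho} |u|^p\, dy$ for $\rho > 0$ (and $h_u^q(\rho)$ means $(h_u(\rho))^q$). $L^{p,q}_b(\mathbb{R}^N)$ is the space of all measurable functions $u : \mathbb{R}^N \to \mathbb{R}$ (identified when equal a.e.) such that $\int_0^\infty \rho^{-b}\, h_u^q(\rho)\, d\rho < \infty$. *)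

theory Defs
  imports "HOL-Analysis.Analysis" "HOL-Algebra.Module"
begin

section \<open>Real normed spaces with an explicit carrier\<close>

definition real_ring :: "real ring" where
  "real_ring = \<lparr>carrier = UNIV, monoid.mult = (*), one = 1, ring.zero = 0, add = (+)\<rparr>"

locale real_normed_space = module real_ring V
  for V :: "(real, 'v, 'm) module_scheme" (structure) and nrm :: "'v \<Rightarrow> real" +
  assumes nrm_nonneg: "x \<in> carrier V \<Longrightarrow> 0 \<le> nrm x"
    and nrm_eq_0_iff: "x \<in> carrier V \<Longrightarrow> nrm x = 0 \<longleftrightarrow> x = \<zero>"
    and nrm_smult: "x \<in> carrier V \<Longrightarrow> nrm (a \<odot> x) = \<bar>a\<bar> * nrm x"
    and nrm_triangle: "x \<in> carrier V \<Longrightarrow> y \<in> carrier V \<Longrightarrow> nrm (x \<oplus> y) \<le> nrm x + nrm y"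

text \<open>The locale \<^locale>\<open>Metric_space\<close> requires non-negativity and symmetry on the whole type,
  hence the default value outside the carrier.\<close>

definition norm_dist :: "(real, 'v, 'm) module_scheme \<Rightarrow> ('v \<Rightarrow> real) \<Rightarrow> 'v \<Rightarrow> 'v \<Rightarrow> real" where
  "norm_dist V nrm x y =
     (if x \<in> carrier V \<and> y \<in> carrier V then nrm (x \<ominus>\<^bsub>V\<^esub> y) else 0)"

locale real_banach_space = real_normed_space +
  assumes complete: "Metric_space.mcomplete (carrier V) (norm_dist V nrm)"

definition uniformly_convex ::
    "(real, 'v, 'm) module_scheme \<Rightarrow> ('v \<Rightarrow> real) \<Rightarrow> bool" where
  "uniformly_convex V nrm \<longleftrightarrow>
     (\<forall>\<epsilon>. 0 < \<epsilon> \<and> \<epsilon> \<le> 2 \<longrightarrow>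
       (\<exists>\<delta>>0. \<forall>x\<in>carrier V. \<forall>y\<in>carrier V.
          nrm x = 1 \<and> nrm y = 1 \<and> nrm (x \<ominus>\<^bsub>V\<^esub> y) \<ge> \<epsilon> \<longrightarrow>
          nrm ((1 / 2) \<odot>\<^bsub>V\<^esub> (x \<oplus>\<^bsub>V\<^esub> y)) \<le> 1 - \<delta>))"

definition uniformly_smooth ::
    "(real, 'v, 'm) module_scheme \<Rightarrow> ('v \<Rightarrow> real) \<Rightarrow> bool" where
  "uniformly_smooth V nrm \<longleftrightarrow>
     (\<forall>\<epsilon>>0. \<exists>\<delta>>0. \<forall>x\<in>carrier V. \<forall>y\<in>carrier V.
        nrm x = 1 \<and> nrm y \<le> \<delta> \<longrightarrow>
        nrm (x \<oplus>\<^bsub>V\<^esub> y) + nrm (x \<ominus>\<^bsub>V\<^esub> y) \<le> 2 + \<epsilon> * nrm y)"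

lemma real_ring_simps [simp]:
  "carrier real_ring = UNIV" "x \<otimes>\<^bsub>real_ring\<^esub> y = x * y" "x \<oplus>\<^bsub>real_ring\<^esub> y = x + y"
  "\<one>\<^bsub>real_ring\<^esub> = 1" "\<zero>\<^bsub>real_ring\<^esub> = 0"
  by (simp_all add: real_ring_def)

lemma cring_real_ring: "cring real_ring"
  by (rule cringI, rule abelian_groupI) 
     (auto simp: algebra_simps intro!: comm_monoidI exI[of _ "- x" for x])

lemma (in real_normed_space) nrm_minus_commute:
  assumes "x \<in> carrier V" "y \<in> carrier V"
  shows "nrm (x \<ominus> y) = nrm (y \<ominus> x)"
proof -
  have "(-1) \<odot> z = \<ominus> z" if "z \<in> carrier V" for z
  proof -
    have "(-1) \<odot> z \<oplus> z = (-1 + 1) \<odot> z"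
      using smult_l_distr[of "-1" 1 z] smult_one[of z] that by simp
    also have "\<dots> = \<zero>"
      using smult_l_null[of z] that by simp
    finally show ?thesis
      using that smult_closed[of "-1" z] by (simp add: M.minus_equality)
  qed
  moreover have "y \<ominus> x = \<ominus> (x \<ominus> y)"
    using assms by (simp add: M.minus_eq M.minus_add M.a_comm)
  ultimately show ?thesis
    using nrm_smult[of "x \<ominus> y" "-1"] assms by simp
qed

lemma (in real_normed_space) Metric_space_norm_dist:
  "Metric_space (carrier V) (norm_dist V nrm)"
proof -
  have [simp]: "x \<ominus> y = \<zero> \<longleftrightarrow> x = y" if "x \<in> carrier V" "y \<in> carrier V" for x y
    using that by (metis M.a_inv_closed M.add.inv_inv M.minus_equality M.minus_eq M.r_neg)
  show ?thesis
  proof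
    fix x y z assume xyz: "x \<in> carrier V" "y \<in> carrier V" "z \<in> carrier V"
    have "x \<ominus> z = (x \<ominus> y) \<oplus> (y \<ominus> z)"
      using xyz by (simp add: M.minus_eq M.a_assoc M.r_neg1)
    then show "norm_dist V nrm x z \<le> norm_dist V nrm x y + norm_dist V nrm y z"
      using nrm_triangle[of "x \<ominus> y" "y \<ominus> z"] xyz by (simp add: norm_dist_def)
  qed (auto simp: norm_dist_def nrm_nonneg nrm_minus_commute nrm_eq_0_iff)
qed

section \<open>Ball-mass Lebesgue spaces\<close>

text \<open>Real powers of extended non-negative reals, for exponents \<open>s > 0\<close>.\<close>

definition ennreal_powr :: "ennreal \<Rightarrow> real \<Rightarrow> ennreal" where
  "ennreal_powr a s = (if a = \<infinity> then \<infinity> else ennreal (enn2real a powr s))"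

definition ball_mass :: "real \<Rightarrow> (real ^ 'n \<Rightarrow> real) \<Rightarrow> real \<Rightarrow> ennreal" where
  "ball_mass p u \<rho> = (\<integral>\<^sup>+ y\<in>ball 0 \<rho>. ennreal (\<bar>u y\<bar> powr p) \<partial>lebesgue)"

definition ball_mass_integral ::
    "real \<Rightarrow> real \<Rightarrow> real \<Rightarrow> (real ^ 'n \<Rightarrow> real) \<Rightarrow> ennreal" where
  "ball_mass_integral p q b u =
     (\<integral>\<^sup>+ \<rho>\<in>{0<..}. ennreal (\<rho> powr (- b)) * ennreal_powr (ball_mass p u \<rho>) q \<partial>lebesgue)"

definition ball_mass_functions ::
    "real \<Rightarrow> real \<Rightarrow> real \<Rightarrow> (real ^ 'n \<Rightarrow> real) set" where
  "ball_mass_functions p q b =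
     {u \<in> borel_measurable lebesgue. ball_mass_integral p q b u < \<infinity>}"

definition ball_mass_norm :: "real \<Rightarrow> real \<Rightarrow> real \<Rightarrow> (real ^ 'n \<Rightarrow> real) \<Rightarrow> real" where
  "ball_mass_norm p q b u = enn2real (ball_mass_integral p q b u) powr (1 / (p * q))"

definition ae_eq :: "((real ^ 'n \<Rightarrow> real) \<times> (real ^ 'n \<Rightarrow> real)) set" where
  "ae_eq = {(u, v). u \<in> borel_measurable lebesgue \<and> v \<in> borel_measurable lebesgue \<and>
                    (AE x in lebesgue. u x = v x)}"

text \<open>The space of equivalence classes. As for other modules in record form, the multiplicative
  fields inherited from \<^typ>\<open>'a ring\<close> play no role.\<close>

definition ball_mass_space ::
    "real \<Rightarrow> real \<Rightarrow> real \<Rightarrow> (real, (real ^ 'n \<Rightarrow> real) set) module" where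
  "ball_mass_space p q b =
     \<lparr>carrier = ball_mass_functions p q b // ae_eq,
      monoid.mult = undefined, one = undefined,
      ring.zero = ae_eq `` {\<lambda>x. 0},
      add = (\<lambda>A B. \<Union>u\<in>A. \<Union>v\<in>B. ae_eq `` {\<lambda>x. u x + v x}),
      smult = (\<lambda>c A. \<Union>u\<in>A. ae_eq `` {\<lambda>x. c * u x})\<rparr>"

definition ball_mass_space_norm ::
    "real \<Rightarrow> real \<Rightarrow> real \<Rightarrow> (real ^ 'n \<Rightarrow> real) set \<Rightarrow> real" where
  "ball_mass_space_norm p q b A = the_elem (ball_mass_norm p q b ` A)"

lemma equiv_ae_eq: "equiv (borel_measurable lebesgue) ae_eq"
proof (rule equivI)
  show "trans ae_eq"
  proof (rule transI)
    fix u v w :: "real ^ 'n \<Rightarrow> real"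
    assume "(u, v) \<in> ae_eq" "(v, w) \<in> ae_eq"
    then show "(u, w) \<in> ae_eq"
      unfolding ae_eq_def by (auto elim: AE_mp)
  qed
qed (auto simp: ae_eq_def refl_on_def sym_def elim: AE_mp)

lemma ball_mass_space_add:
  assumes "u \<in> borel_measurable lebesgue" "v \<in> borel_measurable lebesgue"
  shows "ae_eq `` {u} \<oplus>\<^bsub>ball_mass_space p q b\<^esub> ae_eq `` {v} = ae_eq `` {\<lambda>x. u x + v x}"
proof -
  have "congruent2 ae_eq ae_eq (\<lambda>u v. ae_eq `` {\<lambda>x. u x + v x :: real})"
  proof (rule congruent2I')
    fix u u' v v' :: "real ^ 'n \<Rightarrow> real"
    assume *: "(u, u') \<in> ae_eq" "(v, v') \<in> ae_eq"
    then have "AE x in lebesgue. u x + v x = u' x + v' x"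
      unfolding ae_eq_def by (auto elim!: AE_mp)
    with * have "((\<lambda>x. u x + v x), (\<lambda>x. u' x + v' x)) \<in> ae_eq"
      unfolding ae_eq_def by auto
    then show "ae_eq `` {\<lambda>x. u x + v x} = ae_eq `` {\<lambda>x. u' x + v' x}"
      by (rule equiv_class_eq[OF equiv_ae_eq])
  qed
  from UN_equiv_class2[OF equiv_ae_eq equiv_ae_eq this assms]
  show ?thesis by (simp add: ball_mass_space_def)
qed

lemma ball_mass_space_smult:
  assumes "u \<in> borel_measurable lebesgue"
  shows "c \<odot>\<^bsub>ball_mass_space p q b\<^esub> (ae_eq `` {u}) = ae_eq `` {\<lambda>x. c * u x}"
proof -
  have "congruent ae_eq (\<lambda>u. ae_eq `` {\<lambda>x. c * u x :: real})"
  proof (rule congruentI)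
    fix u u' :: "real ^ 'n \<Rightarrow> real"
    assume *: "(u, u') \<in> ae_eq"
    then have "AE x in lebesgue. c * u x = c * u' x"
      unfolding ae_eq_def by (auto elim!: AE_mp)
    with * have "((\<lambda>x. c * u x), (\<lambda>x. c * u' x)) \<in> ae_eq"
      unfolding ae_eq_def by auto
    then show "ae_eq `` {\<lambda>x. c * u x} = ae_eq `` {\<lambda>x. c * u' x}"
      by (rule equiv_class_eq[OF equiv_ae_eq])
  qed
  from UN_equiv_class[OF equiv_ae_eq this assms]
  show ?thesis by (simp add: ball_mass_space_def)
qed

lemma ball_mass_integral_cong:
  assumes "(u, v) \<in> ae_eq"
  shows "ball_mass_integral p q b u = ball_mass_integral p q b v"
proof -
  have "AE y in lebesgue. u y = v y"
    using assms by (simp add: ae_eq_def)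
  then have "ball_mass p u = ball_mass p v"
    unfolding ball_mass_def by (intro ext nn_integral_cong_AE) (auto elim!: AE_mp)
  then show ?thesis
    by (simp add: ball_mass_integral_def)
qed

lemma ball_mass_space_norm:
  assumes "u \<in> borel_measurable lebesgue"
  shows "ball_mass_space_norm p q b (ae_eq `` {u}) = ball_mass_norm p q b u"
proof -
  have "u \<in> ae_eq `` {u}"
    using assms by (rule equiv_class_self[OF equiv_ae_eq])
  moreover have "ball_mass_norm p q b v = ball_mass_norm p q b u" if "v \<in> ae_eq `` {u}" for v
    using ball_mass_integral_cong[of u v] that by (simp add: ball_mass_norm_def)
  ultimately have "ball_mass_norm p q b ` (ae_eq `` {u}) = {ball_mass_norm p q b u}"
    by blast
  then show ?thesis
    by (simp add: ball_mass_space_norm_def)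
qed

end

theory Submission
  imports Defs
begin

text \<open>
  The norm is that of \<open>L\<^sup>r\<close> functions of the radius with values in \<open>L\<^sup>p\<close>, where \<open>r = p q\<close>.  Its
  \<open>r\<close>-th power, the modular, arises from the scalar function \<open>\<bar>s\<bar> powr p\<close> in three steps: integrate over
  a ball, raise to the power \<open>q\<close>, integrate over the radius with a weight.  The three properties of the scalar
  function that matter are convexity, a quantitative strict convexity
  \<open>\<bar>s - t\<bar>\<^sup>p \<le> \<epsilon> (\<bar>s\<bar>\<^sup>p + \<bar>t\<bar>\<^sup>p) + C ((\<bar>s\<bar>\<^sup>p + \<bar>t\<bar>\<^sup>p) / 2 - \<bar>(s + t) / 2\<bar>\<^sup>p)\<close> with \<open>C\<close> depending on \<open>\<epsilon>\<close>,
  and a quantitative differentiability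
  \<open>\<bar>s + \<tau> t\<bar>\<^sup>p + \<bar>s - \<tau> t\<bar>\<^sup>p \<le> 2 \<bar>s\<bar>\<^sup>p + \<epsilon> \<tau> (\<bar>s\<bar>\<^sup>p + \<bar>t\<bar>\<^sup>p)\<close> for \<open>0 < \<tau> \<le> \<delta>\<close> with \<open>\<delta>\<close> depending on \<open>\<epsilon>\<close>;
  the last two hold for \<open>p > 1\<close> (\<open>abs_powr_uniformly_convex\<close>, \<open>abs_powr_uniformly_smooth\<close>).

  These inequalities are linear in the \<open>p\<close>-th powers, so they survive both integrations
  (\<open>integral_le_linear_combination\<close>), and they survive the power \<open>q \<ge> 1\<close> by
  \<open>powr_uniformly_convex_step\<close> and \<open>powr_uniformly_smooth_step\<close>.  The modular therefore has all three
  properties.  For a functional homogeneous of degree \<open>r\<close> they give the triangle inequality, uniform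
  convexity and uniform smoothness of its \<open>r\<close>-th root on comparing unit vectors, with no appeal to
  duality or to the inequalities of Hoelder and Minkowski.

  For completeness, a Cauchy sequence has a rapidly converging subsequence, which converges almost
  everywhere because the modular bounds the mass on each ball
  (\<open>AE_convergent_if_rapidly_Cauchy\<close>).  Fatou's lemma, applied over the balls and over the
  radius, shows that its pointwise limit is the limit in norm (\<open>ball_mass_complete\<close>).
\<close>

section \<open>Convexity and smoothness of powers of the absolute value\<close>

lemma abs_powr_convex:
  fixes s w t p :: real
  assumes p: "1 \<le> p" and t: "0 \<le> t" "t \<le> 1"
  shows "\<bar>(1 - t) * s + t * w\<bar> powr p \<le> (1 - t) * \<bar>s\<bar> powr p + t * \<bar>w\<bar> powr p"
proof -
  have nonneg: "((1 - t) * a + t * c) powr p \<le> (1 - t) * a powr p + t * c powr p"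
    if a: "0 \<le> a" and c: "0 \<le> c" for a c :: real
  proof -
    have scale: "r powr p \<le> r" if "0 \<le> r" "r \<le> 1" for r :: real
      using powr_mono'[of 1 p r] p that by simp
    consider "a = 0" | "c = 0" | "0 < a" "0 < c"
      using a c by linarith
    then show ?thesis
    proof cases
      case 1
      then show ?thesis
        using c t p scale[of t] by (simp add: powr_mult mult_right_mono)
    next
      case 2
      then show ?thesis
        using a t p scale[of "1 - t"] by (simp add: powr_mult mult_right_mono)
    next
      case 3
      then show ?thesis
        using convex_onD[OF powr_convex[OF p], of t a c] t by simp
    qed
  qed
  have "\<bar>(1 - t) * s + t * w\<bar> \<le> (1 - t) * \<bar>s\<bar> + t * \<bar>w\<bar>"
    using abs_triangle_ineq[of "(1 - t) * s" "t * w"] t by (simp add: abs_mult)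
  then have "\<bar>(1 - t) * s + t * w\<bar> powr p \<le> ((1 - t) * \<bar>s\<bar> + t * \<bar>w\<bar>) powr p"
    using p by (intro powr_mono2) auto
  also have "\<dots> \<le> (1 - t) * \<bar>s\<bar> powr p + t * \<bar>w\<bar> powr p"
    by (rule nonneg) auto
  finally show ?thesis .
qed

lemma powr_add_le:
  fixes a c q :: real
  assumes q: "1 \<le> q" and "0 \<le> a" "0 \<le> c"
  shows "(a + c) powr q \<le> 2 powr q * (a powr q + c powr q)"
proof -
  have "(a + c) powr q \<le> (2 * max a c) powr q"
    using assms by (intro powr_mono2) auto
  also have "\<dots> = 2 powr q * (max a c) powr q"
    by (simp add: powr_mult)
  also have "\<dots> \<le> 2 powr q * (a powr q + c powr q)"
    by (intro mult_left_mono) (auto simp: max_def)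
  finally show ?thesis .
qed

lemma abs_powr_add_le:
  fixes s t p :: real
  assumes "1 \<le> p"
  shows "\<bar>s + t\<bar> powr p \<le> 2 powr p * (\<bar>s\<bar> powr p + \<bar>t\<bar> powr p)"
  using powr_add_le[OF assms, of "\<bar>s\<bar>" "\<bar>t\<bar>"] powr_mono2[of p "\<bar>s + t\<bar>" "\<bar>s\<bar> + \<bar>t\<bar>"] assms
  by (simp add: abs_triangle_ineq)

lemma powr_superadditive:
  fixes a c q :: real
  assumes q: "1 \<le> q" and a: "0 \<le> a" and c: "0 \<le> c"
  shows "a powr q + c powr q \<le> (a + c) powr q"
proof (cases "a + c = 0")
  case False
  then have pos: "0 < a + c" using a c by simp
  have *: "x powr q \<le> x / (a + c) * (a + c) powr q" if "0 \<le> x" "x \<le> a + c" for x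
  proof -
    have "(x / (a + c)) powr q \<le> x / (a + c)"
      using powr_mono'[of 1 q "x / (a + c)"] q that pos by simp
    then have "x powr q / (a + c) powr q \<le> x / (a + c)"
      by (simp add: powr_divide)
    then show ?thesis using pos by (simp add: divide_le_eq)
  qed
  have "a powr q + c powr q \<le> (a / (a + c) + c / (a + c)) * (a + c) powr q"
    using *[of a] *[of c] a c by (simp add: distrib_right)
  also have "\<dots> = (a + c) powr q"
    using pos by (simp add: add_divide_distrib[symmetric])
  finally show ?thesis .
qed (use a c add_nonneg_eq_0_iff[OF a c] in auto)

lemma midpoint_powr_less:
  fixes z p :: real
  assumes p: "1 < p" and z: "-1 \<le> z" "z < 1"
  shows "\<bar>(z + 1) / 2\<bar> powr p < (\<bar>z\<bar> powr p + 1) / 2"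
proof (cases "z = -1")
  case False
  define f where "f x = (x powr p + 1) / 2 - ((x + 1) / 2) powr p" for x :: real
  define a where "a = \<bar>z\<bar>"
  have a: "0 \<le> a" "a < 1" using z False by (auto simp: a_def)
  have "f 1 < f a"
  proof (rule DERIV_neg_imp_decreasing_open[OF a(2)])
    fix x assume x: "a < x" "x < 1"
    have "(f has_real_derivative (p / 2) * (x powr (p - 1) - ((x + 1) / 2) powr (p - 1))) (at x)"
      unfolding f_def using x a p
      by (auto intro!: derivative_eq_intros simp: field_simps)
    moreover have "x powr (p - 1) < ((x + 1) / 2) powr (p - 1)"
      using x a p by (intro powr_less_mono2) auto
    ultimately show "\<exists>y. (f has_real_derivative y) (at x) \<and> y < 0"
      using p mult_pos_neg[of "p / 2" "x powr (p - 1) - ((x + 1) / 2) powr (p - 1)"] by auto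
  next
    show "continuous_on {a..1} f"
      unfolding f_def using p a by (intro continuous_on_powr' continuous_intros) auto
  qed
  then have "((a + 1) / 2) powr p < (a powr p + 1) / 2"
    by (simp add: f_def)
  moreover have "\<bar>(z + 1) / 2\<bar> powr p \<le> ((a + 1) / 2) powr p"
    using p z by (intro powr_mono2) (auto simp: a_def)
  ultimately show ?thesis by (simp add: a_def)
qed auto

text \<open>By homogeneity and symmetry it suffices to take \<open>t = 1\<close> and \<open>\<bar>s\<bar> \<le> 1\<close>.  There the gap in brackets
  is positive away from \<open>s = 1\<close>, hence bounded below on the compact set where the term with
  \<open>\<epsilon>\<close> does not suffice.\<close>

lemma abs_powr_uniformly_convex:
  fixes p \<epsilon> :: real
  assumes p: "1 < p" and \<epsilon>: "0 < \<epsilon>"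
  obtains C where "0 \<le> C"
    and "\<And>s t :: real. \<bar>s - t\<bar> powr p \<le> \<epsilon> * (\<bar>s\<bar> powr p + \<bar>t\<bar> powr p)
           + C * ((\<bar>s\<bar> powr p + \<bar>t\<bar> powr p) / 2 - \<bar>(s + t) / 2\<bar> powr p)"
proof -
  define g where "g z = (\<bar>z\<bar> powr p + 1) / 2 - \<bar>(z + 1) / 2\<bar> powr p" for z :: real
  define K where "K = {-1..1} \<inter> {z :: real. \<epsilon> * (\<bar>z\<bar> powr p + 1) \<le> \<bar>z - 1\<bar> powr p}"
  have "closed {z :: real. \<epsilon> * (\<bar>z\<bar> powr p + 1) \<le> \<bar>z - 1\<bar> powr p}"
    using p by (intro closed_Collect_le continuous_on_powr' continuous_intros) auto
  then have cK: "compact K"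
    unfolding K_def by (intro compact_Int_closed) auto
  have cg: "continuous_on K g"
    unfolding g_def using p by (intro continuous_on_powr' continuous_intros) auto
  have gpos: "0 < g z" if "z \<in> K" for z
  proof -
    have "0 < \<epsilon> * (\<bar>z\<bar> powr p + 1)"
      using \<epsilon> by (intro mult_pos_pos add_nonneg_pos) auto
    then have "z \<noteq> 1"
      using that p by (auto simp: K_def)
    then show ?thesis
      using midpoint_powr_less[OF p, of z] that by (auto simp: g_def K_def)
  qed
  have g0: "0 \<le> g z" if "\<bar>z\<bar> \<le> 1" for z
    using midpoint_powr_less[OF p, of z] that by (cases "z = 1") (auto simp: g_def abs_le_iff)
  obtain m where m: "0 < m" "\<And>z. z \<in> K \<Longrightarrow> m \<le> g z"
  proof (cases "K = {}")
    case True
    then show ?thesis using that[of 1] by simp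
  next
    case False
    then obtain z0 where "z0 \<in> K" "\<forall>z\<in>K. g z0 \<le> g z"
      using continuous_attains_inf[OF cK _ cg] by blast
    then show ?thesis using that[of "g z0"] gpos by blast
  qed
  define C where "C = 2 powr p / m"
  have C0: "0 \<le> C" using m by (simp add: C_def)
  have one: "\<bar>z - 1\<bar> powr p \<le> \<epsilon> * (\<bar>z\<bar> powr p + 1) + C * g z" if z: "\<bar>z\<bar> \<le> 1" for z
  proof (cases "z \<in> K")
    case True
    have "\<bar>z - 1\<bar> powr p \<le> 2 powr p"
      using z p by (intro powr_mono2) auto
    also have "\<dots> = C * m" using m by (simp add: C_def)
    also have "\<dots> \<le> C * g z" using m(2)[OF True] C0 by (intro mult_left_mono)
    finally show ?thesis using \<epsilon> by (simp add: add_increasing)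
  next
    case False
    then have "\<bar>z - 1\<bar> powr p \<le> \<epsilon> * (\<bar>z\<bar> powr p + 1)"
      using z by (auto simp: K_def)
    then show ?thesis using g0[OF z] C0 by (simp add: add_increasing2)
  qed
  have ordered: "\<bar>s - t\<bar> powr p \<le> \<epsilon> * (\<bar>s\<bar> powr p + \<bar>t\<bar> powr p)
           + C * ((\<bar>s\<bar> powr p + \<bar>t\<bar> powr p) / 2 - \<bar>(s + t) / 2\<bar> powr p)"
    if "\<bar>s\<bar> \<le> \<bar>t\<bar>" for s t :: real
  proof (cases "t = 0")
    case False
    define z where "z = s / t"
    have s: "s = z * t" and z: "\<bar>z\<bar> \<le> 1"
      using that False by (auto simp: z_def divide_le_eq)
    have e: "\<bar>s - t\<bar> = \<bar>t\<bar> * \<bar>z - 1\<bar>" "\<bar>(s + t) / 2\<bar> = \<bar>t\<bar> * \<bar>(z + 1) / 2\<bar>" "\<bar>s\<bar> = \<bar>t\<bar> * \<bar>z\<bar>"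
      by (auto simp: s abs_mult[symmetric] algebra_simps)
    show ?thesis
      unfolding e powr_mult
      using mult_left_mono[OF one[OF z], of "\<bar>t\<bar> powr p"] by (simp add: g_def algebra_simps)
  qed (use that in auto)
  show ?thesis
  proof (rule that[OF C0])
    fix s t :: real
    show "\<bar>s - t\<bar> powr p \<le> \<epsilon> * (\<bar>s\<bar> powr p + \<bar>t\<bar> powr p)
           + C * ((\<bar>s\<bar> powr p + \<bar>t\<bar> powr p) / 2 - \<bar>(s + t) / 2\<bar> powr p)"
      using ordered[of s t] ordered[of t s] 
      by (cases "\<bar>s\<bar> \<le> \<bar>t\<bar>") (auto simp: abs_minus_commute add.commute)
  qed
qed

text \<open>If \<open>\<tau> \<bar>t\<bar>\<close> is small relative to \<open>\<bar>s\<bar>\<close>, the inequality expresses that the even part of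
  \<open>(1 + x) powr p\<close> has derivative \<open>0\<close> at \<open>0\<close>.  Otherwise the left side is at most a constant times
  \<open>\<tau> powr p * \<bar>t\<bar> powr p\<close>, and \<open>\<tau> powr p\<close> is small compared with \<open>\<tau>\<close> since \<open>p > 1\<close>.\<close>

lemma abs_powr_uniformly_smooth:
  fixes p \<epsilon> :: real
  assumes p: "1 < p" and \<epsilon>: "0 < \<epsilon>"
  obtains \<delta> where "0 < \<delta>" "\<delta> \<le> 1"
    and "\<And>\<tau> s t :: real. 0 < \<tau> \<Longrightarrow> \<tau> \<le> \<delta> \<Longrightarrow>
       \<bar>s + \<tau> * t\<bar> powr p + \<bar>s - \<tau> * t\<bar> powr p \<le> 2 * \<bar>s\<bar> powr p + \<epsilon> * \<tau> * (\<bar>s\<bar> powr p + \<bar>t\<bar> powr p)"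
proof -
  define f where "f x = (1 + x) powr p + (1 - x) powr p" for x :: real
  have "(f has_real_derivative 0) (at 0)"
    unfolding f_def using p by (auto intro!: derivative_eq_intros)
  then have "((\<lambda>x. (f x - f 0) / x) \<longlongrightarrow> 0) (at 0)"
    by (simp add: has_field_derivative_iff)
  then obtain \<eta>0 where \<eta>0: "0 < \<eta>0" "\<And>x. x \<noteq> 0 \<Longrightarrow> \<bar>x\<bar> < \<eta>0 \<Longrightarrow> \<bar>(f x - f 0) / x\<bar> < \<epsilon>"
    using LIM_D[OF _ \<epsilon>] by (metis (no_types, lifting) diff_zero real_norm_def)
  define \<eta> where "\<eta> = min (\<eta>0 / 2) 1"
  have \<eta>: "0 < \<eta>" "\<eta> \<le> 1" "\<eta> < \<eta>0" using \<eta>0 by (auto simp: \<eta>_def)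
  have near: "\<bar>1 + x\<bar> powr p + \<bar>1 - x\<bar> powr p \<le> 2 + \<epsilon> * \<bar>x\<bar>" if "\<bar>x\<bar> \<le> \<eta>" for x
  proof (cases "x = 0")
    case False
    have "\<bar>f x - 2\<bar> < \<epsilon> * \<bar>x\<bar>"
      using \<eta>0(2)[of x] False that \<eta> by (simp add: f_def divide_less_eq)
    then show ?thesis using that \<eta> by (simp add: f_def)
  qed auto
  define c where "c = 2 * (1 + 1 / \<eta>) powr p"
  have c: "0 < c" using \<eta> add_pos_pos[of 1 "1 / \<eta>"] by (simp add: c_def)
  define \<delta> where "\<delta> = min 1 ((\<epsilon> / c) powr (1 / (p - 1)))"
  show ?thesis
  proof (rule that[of \<delta>])
    show "0 < \<delta>" "\<delta> \<le> 1" using c \<epsilon> by (auto simp: \<delta>_def)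
    fix \<tau> s t :: real assume \<tau>: "0 < \<tau>" "\<tau> \<le> \<delta>"
    have "\<tau> powr (p - 1) \<le> ((\<epsilon> / c) powr (1 / (p - 1))) powr (p - 1)"
      using \<tau> p by (intro powr_mono2) (auto simp: \<delta>_def)
    also have "\<dots> = \<epsilon> / c" using p c \<epsilon> by (simp add: powr_powr)
    finally have "c * \<tau> powr (p - 1) \<le> \<epsilon>" using c by (simp add: field_simps)
    then have small: "c * \<tau> powr p \<le> \<epsilon> * \<tau>"
      using \<tau> mult_right_mono[of "c * \<tau> powr (p - 1)" \<epsilon> \<tau>] powr_add[of \<tau> "p - 1" 1]
      by (simp add: mult.assoc)
    show "\<bar>s + \<tau> * t\<bar> powr p + \<bar>s - \<tau> * t\<bar> powr p
        \<le> 2 * \<bar>s\<bar> powr p + \<epsilon> * \<tau> * (\<bar>s\<bar> powr p + \<bar>t\<bar> powr p)"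
    proof (cases "\<tau> * \<bar>t\<bar> \<le> \<eta> * \<bar>s\<bar>")
      case True
      show ?thesis
      proof (cases "s = 0")
        case True
        with \<open>\<tau> * \<bar>t\<bar> \<le> \<eta> * \<bar>s\<bar>\<close> have "t = 0" using \<tau> by (simp add: mult_le_0_iff)
        with True show ?thesis by simp
      next
        case False
        define x where "x = \<tau> * t / s"
        have x: "\<bar>x\<bar> \<le> \<eta>" using True False \<tau> by (simp add: x_def abs_mult divide_le_eq)
        have e: "\<bar>s + \<tau> * t\<bar> = \<bar>s\<bar> * \<bar>1 + x\<bar>" "\<bar>s - \<tau> * t\<bar> = \<bar>s\<bar> * \<bar>1 - x\<bar>"
          using False by (auto simp: x_def abs_mult[symmetric] algebra_simps)
        have "\<bar>s\<bar> powr p * \<bar>x\<bar> = \<tau> * (\<bar>s\<bar> powr (p - 1) * \<bar>t\<bar>)"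
          using False \<tau> by (simp add: x_def abs_mult powr_diff)
        also have "\<bar>s\<bar> powr (p - 1) * \<bar>t\<bar> \<le> \<bar>s\<bar> powr p + \<bar>t\<bar> powr p"
        proof (cases "\<bar>s\<bar> \<le> \<bar>t\<bar>")
          case True
          have "\<bar>s\<bar> powr (p - 1) * \<bar>t\<bar> \<le> \<bar>t\<bar> powr (p - 1) * \<bar>t\<bar>"
            using True p by (intro mult_right_mono powr_mono2) auto
          also have "\<dots> = \<bar>t\<bar> powr p" using powr_add[of "\<bar>t\<bar>" "p - 1" 1] by simp
          finally show ?thesis by (simp add: add_increasing)
        next
          case False
          have "\<bar>s\<bar> powr (p - 1) * \<bar>t\<bar> \<le> \<bar>s\<bar> powr (p - 1) * \<bar>s\<bar>"
            using False by (intro mult_left_mono) auto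
          also have "\<dots> = \<bar>s\<bar> powr p" using powr_add[of "\<bar>s\<bar>" "p - 1" 1] by simp
          finally show ?thesis by (simp add: add_increasing2)
        qed
        finally have bd: "\<bar>s\<bar> powr p * \<bar>x\<bar> \<le> \<tau> * (\<bar>s\<bar> powr p + \<bar>t\<bar> powr p)"
          using \<tau> by simp
        have "\<bar>s\<bar> powr p * (\<bar>1 + x\<bar> powr p + \<bar>1 - x\<bar> powr p) \<le> \<bar>s\<bar> powr p * (2 + \<epsilon> * \<bar>x\<bar>)"
          using near[OF x] by (intro mult_left_mono) auto
        also have "\<dots> = 2 * \<bar>s\<bar> powr p + \<epsilon> * (\<bar>s\<bar> powr p * \<bar>x\<bar>)"
          by (simp add: algebra_simps)
        also have "\<dots> \<le> 2 * \<bar>s\<bar> powr p + \<epsilon> * (\<tau> * (\<bar>s\<bar> powr p + \<bar>t\<bar> powr p))"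
          using bd \<epsilon> by (intro add_left_mono mult_left_mono) auto
        finally show ?thesis
          unfolding e powr_mult by (simp add: algebra_simps)
      qed
    next
      case False
      have s: "\<bar>s\<bar> \<le> \<tau> * \<bar>t\<bar> / \<eta>" using False \<eta> by (simp add: field_simps)
      have each: "\<bar>r\<bar> powr p \<le> (\<tau> * \<bar>t\<bar> * (1 + 1 / \<eta>)) powr p" if "\<bar>r\<bar> \<le> \<bar>s\<bar> + \<tau> * \<bar>t\<bar>" for r
        using that s p by (intro powr_mono2) (auto simp: algebra_simps)
      have "\<bar>s + \<tau> * t\<bar> powr p + \<bar>s - \<tau> * t\<bar> powr p \<le> 2 * (\<tau> * \<bar>t\<bar> * (1 + 1 / \<eta>)) powr p"
        using each[of "s + \<tau> * t"] each[of "s - \<tau> * t"] \<tau>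
          abs_triangle_ineq[of s "\<tau> * t"] abs_triangle_ineq4[of s "\<tau> * t"]
        by (simp add: abs_mult)
      also have "\<dots> = (c * \<tau> powr p) * \<bar>t\<bar> powr p"
        by (simp add: c_def powr_mult)
      also have "\<dots> \<le> \<epsilon> * \<tau> * \<bar>t\<bar> powr p"
        using small by (intro mult_right_mono) auto
      also have "\<dots> \<le> 2 * \<bar>s\<bar> powr p + \<epsilon> * \<tau> * (\<bar>s\<bar> powr p + \<bar>t\<bar> powr p)"
        using \<epsilon> \<tau> by (simp add: distrib_left add_increasing)
      finally show ?thesis .
    qed
  qed
qed

section \<open>Raising the inequalities to a power at least one\<close>

text \<open>In the application \<open>a\<close>, \<open>c\<close>, \<open>m\<close>, \<open>d\<close> are the masses on a ball of two functions, of their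
  midpoint and of their difference.  Superadditivity of \<open>x powr q\<close> turns the convexity gap of the
  masses into the convexity gap of their powers.\<close>

lemma powr_uniformly_convex_step:
  fixes q \<epsilon> C a c m d :: real
  assumes q: "1 \<le> q" and "0 \<le> \<epsilon>" "0 \<le> C" and "0 \<le> a" "0 \<le> c" "0 \<le> m" "0 \<le> d"
    and m: "m \<le> (a + c) / 2"
    and d: "d \<le> \<epsilon> * (a + c) + C * ((a + c) / 2 - m)"
  shows "d powr q \<le> (4 * \<epsilon>) powr q * (a powr q + c powr q)
           + (2 * C) powr q * ((a powr q + c powr q) / 2 - m powr q)"
proof -
  have "((a + c) / 2 - m) powr q + m powr q \<le> ((a + c) / 2) powr q"
    using powr_superadditive[OF q, of "(a + c) / 2 - m" m] assms by simp
  moreover have "((a + c) / 2) powr q \<le> (a powr q + c powr q) / 2"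
    using abs_powr_convex[OF q, of "1/2" a c] assms by (simp add: field_simps)
  ultimately have gap: "((a + c) / 2 - m) powr q \<le> (a powr q + c powr q) / 2 - m powr q"
    by linarith
  have "d powr q \<le> (\<epsilon> * (a + c) + C * ((a + c) / 2 - m)) powr q"
    using assms by (intro powr_mono2) auto
  also have "\<dots> \<le> 2 powr q * ((\<epsilon> * (a + c)) powr q + (C * ((a + c) / 2 - m)) powr q)"
    using assms by (intro powr_add_le) auto
  also have "\<dots> = (2 * \<epsilon>) powr q * (a + c) powr q + (2 * C) powr q * ((a + c) / 2 - m) powr q"
    by (simp only: powr_mult distrib_left[of "2 powr q"] mult.assoc)
  also have "\<dots> \<le> (2 * \<epsilon>) powr q * (2 powr q * (a powr q + c powr q))
      + (2 * C) powr q * ((a powr q + c powr q) / 2 - m powr q)"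
    using gap powr_add_le[OF q \<open>0 \<le> a\<close> \<open>0 \<le> c\<close>] by (intro add_mono mult_left_mono) auto
  also have "(2 * \<epsilon>) powr q * (2 powr q * (a powr q + c powr q)) = (4 * \<epsilon>) powr q * (a powr q + c powr q)"
    using powr_mult[of 2 2 q] by (simp add: powr_mult)
  finally show ?thesis .
qed

text \<open>The exponent \<open>q = 1\<close> is admissible because both summands on the left have nonnegative base.\<close>

lemma powr_uniformly_smooth:
  fixes q \<epsilon> :: real
  assumes q: "1 \<le> q" and \<epsilon>: "0 < \<epsilon>"
  obtains \<delta> where "0 < \<delta>" "\<delta> \<le> 1"
    and "\<And>\<tau> s t :: real. 0 < \<tau> \<Longrightarrow> \<tau> \<le> \<delta> \<Longrightarrow> \<bar>\<tau> * t\<bar> \<le> s \<Longrightarrow>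
       (s + \<tau> * t) powr q + (s - \<tau> * t) powr q \<le> 2 * s powr q + \<epsilon> * \<tau> * (s powr q + \<bar>t\<bar> powr q)"
proof (cases "q = 1")
  case True
  show ?thesis
  proof (rule that[of 1])
    fix \<tau> s t :: real
    assume *: "0 < \<tau>" "\<bar>\<tau> * t\<bar> \<le> s"
    then have "0 \<le> s + \<tau> * t" "0 \<le> s - \<tau> * t" "0 \<le> s" by linarith+
    then show "(s + \<tau> * t) powr q + (s - \<tau> * t) powr q
        \<le> 2 * s powr q + \<epsilon> * \<tau> * (s powr q + \<bar>t\<bar> powr q)"
      using True * \<epsilon> by simp
  qed auto
next
  case False
  then have "1 < q" using q by simp
  from abs_powr_uniformly_smooth[OF this \<epsilon>] obtain \<delta> where \<delta>: "0 < \<delta>" "\<delta> \<le> 1"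
    and *: "\<And>\<tau> s t :: real. 0 < \<tau> \<Longrightarrow> \<tau> \<le> \<delta> \<Longrightarrow> \<bar>s + \<tau> * t\<bar> powr q + \<bar>s - \<tau> * t\<bar> powr q
        \<le> 2 * \<bar>s\<bar> powr q + \<epsilon> * \<tau> * (\<bar>s\<bar> powr q + \<bar>t\<bar> powr q)"
    by blast
  show ?thesis
  proof (rule that[OF \<delta>])
    fix \<tau> s t :: real
    assume **: "0 < \<tau>" "\<tau> \<le> \<delta>" "\<bar>\<tau> * t\<bar> \<le> s"
    then have "0 \<le> s + \<tau> * t" "0 \<le> s - \<tau> * t" "0 \<le> s" by linarith+
    then show "(s + \<tau> * t) powr q + (s - \<tau> * t) powr q
        \<le> 2 * s powr q + \<epsilon> * \<tau> * (s powr q + \<bar>t\<bar> powr q)"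
      using *[of \<tau> s t] ** by simp
  qed
qed

text \<open>Here \<open>f\<close> and \<open>g\<close> are the masses of \<open>u + \<tau> w\<close> and \<open>u - \<tau> w\<close>, and \<open>a\<close>, \<open>c\<close> those of \<open>u\<close> and \<open>w\<close>.
  For \<open>q > 1\<close> a bound on \<open>f + g\<close> alone does not control \<open>f powr q + g powr q\<close>, so it is also needed
  that \<open>f\<close> and \<open>g\<close> differ by at most a multiple of \<open>\<tau> (a + c)\<close>.\<close>

lemma powr_uniformly_smooth_step:
  fixes q \<epsilon> K :: real
  assumes q: "1 \<le> q" and \<epsilon>: "0 < \<epsilon>" and K: "0 \<le> K"
  obtains \<epsilon>' \<delta> where "0 < \<epsilon>'" "0 < \<delta>" "\<delta> \<le> 1"
    and "\<And>\<tau> a c f g :: real. 0 < \<tau> \<Longrightarrow> \<tau> \<le> \<delta> \<Longrightarrow> 0 \<le> a \<Longrightarrow> 0 \<le> c \<Longrightarrow> 0 \<le> f \<Longrightarrow> 0 \<le> g \<Longrightarrow>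
       f + g \<le> 2 * a + \<epsilon>' * \<tau> * (a + c) \<Longrightarrow> \<bar>f - g\<bar> \<le> K * \<tau> * (a + c) \<Longrightarrow>
       f powr q + g powr q \<le> 2 * a powr q + \<epsilon> * \<tau> * (a powr q + c powr q)"
proof -
  define \<epsilon>1 where "\<epsilon>1 = min 1 (\<epsilon> / (2 * 4 powr q))"
  define L where "L = 2 powr q + K powr q"
  define \<epsilon>2 where "\<epsilon>2 = \<epsilon> / (2 * 2 powr q * L)"
  have L: "0 < L" by (simp add: L_def add_pos_nonneg)
  have \<epsilon>1: "0 < \<epsilon>1" "\<epsilon>1 \<le> 1" "\<epsilon>1 * 4 powr q \<le> \<epsilon> / 2" and \<epsilon>2: "0 < \<epsilon>2" "\<epsilon>2 * L * 2 powr q = \<epsilon> / 2"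
    using \<epsilon> L by (auto simp: \<epsilon>1_def \<epsilon>2_def min_def field_simps)
  from powr_uniformly_smooth[OF q \<epsilon>2(1)] obtain \<delta> where \<delta>: "0 < \<delta>" "\<delta> \<le> 1"
    and sm: "\<And>\<tau> s t :: real. 0 < \<tau> \<Longrightarrow> \<tau> \<le> \<delta> \<Longrightarrow> \<bar>\<tau> * t\<bar> \<le> s \<Longrightarrow>
       (s + \<tau> * t) powr q + (s - \<tau> * t) powr q \<le> 2 * s powr q + \<epsilon>2 * \<tau> * (s powr q + \<bar>t\<bar> powr q)"
    by blast
  show ?thesis
  proof (rule that[OF \<epsilon>1(1) \<delta>])
    fix \<tau> a c f g :: real
    assume \<tau>: "0 < \<tau>" "\<tau> \<le> \<delta>" and nonneg: "0 \<le> a" "0 \<le> c" "0 \<le> f" "0 \<le> g"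
      and sum: "f + g \<le> 2 * a + \<epsilon>1 * \<tau> * (a + c)" and dif: "\<bar>f - g\<bar> \<le> K * \<tau> * (a + c)"
    \<comment> \<open>Write \<open>f = s + \<tau> t\<close> and \<open>g = s - \<tau> t\<close>, where \<open>t\<close> is bounded by a multiple of \<open>H = a + c\<close>.\<close>
    define s t H where "s = (f + g) / 2" and "t = (f - g) / (2 * \<tau>)" and "H = a + c"
    have H: "0 \<le> H" using nonneg by (simp add: H_def)
    have fg: "f = s + \<tau> * t" "g = s - \<tau> * t"
      using \<tau> by (auto simp: s_def t_def field_simps)
    have ts: "\<bar>\<tau> * t\<bar> \<le> s"
      using nonneg \<tau> by (auto simp: s_def t_def)
    have "\<bar>t\<bar> * \<tau> \<le> \<bar>f - g\<bar>"
      using \<tau> by (simp add: t_def)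
    also have "\<dots> \<le> K * \<tau> * (a + c)"
      by (rule dif)
    also have "\<dots> = (K * H) * \<tau>"
      by (simp add: H_def mult_ac)
    finally have tH: "\<bar>t\<bar> \<le> K * H" using \<tau> by simp
    define \<theta> where "\<theta> = \<epsilon>1 * \<tau> / 2"
    have "\<epsilon>1 * \<tau> \<le> 1" using \<epsilon>1 \<tau> \<delta> by (intro mult_le_one) auto
    then have \<theta>: "0 \<le> \<theta>" "\<theta> \<le> 1" using \<epsilon>1 \<tau> by (auto simp: \<theta>_def)
    have "s \<le> a + \<theta> * H" using sum by (simp add: s_def \<theta>_def H_def)
    also have "\<dots> = (1 - \<theta>) * a + \<theta> * (a + H)" by (simp add: algebra_simps)
    finally have "s powr q \<le> ((1 - \<theta>) * a + \<theta> * (a + H)) powr q"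
      using q ts by (intro powr_mono2) auto
    also have "\<dots> \<le> (1 - \<theta>) * a powr q + \<theta> * (a + H) powr q"
      using abs_powr_convex[OF q \<theta>, of a "a + H"] nonneg H \<theta> by simp
    also have "\<dots> \<le> a powr q + \<theta> * (2 * H) powr q"
    proof (intro add_mono mult_left_mono powr_mono2)
      show "(1 - \<theta>) * a powr q \<le> a powr q"
        using \<theta> by (simp add: mult_left_le_one_le)
    qed (use nonneg q \<theta> in \<open>auto simp: H_def\<close>)
    finally have sq: "s powr q \<le> a powr q + \<theta> * (2 powr q * H powr q)"
      by (simp add: powr_mult)
    have "s \<le> 2 * H"
      using \<open>s \<le> a + \<theta> * H\<close> mult_right_mono[OF \<theta>(2) H] nonneg by (simp add: H_def)
    then have sq': "s powr q \<le> 2 powr q * H powr q"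
      using powr_mono2[of q s "2 * H"] q ts by (simp add: powr_mult)
    have tq: "\<bar>t\<bar> powr q \<le> K powr q * H powr q"
      using powr_mono2[of q "\<bar>t\<bar>" "K * H"] q tH by (simp add: powr_mult)
    have Hq: "H powr q \<le> 2 powr q * (a powr q + c powr q)"
      unfolding H_def using nonneg q by (intro powr_add_le)
    have "f powr q + g powr q \<le> 2 * s powr q + \<epsilon>2 * \<tau> * (s powr q + \<bar>t\<bar> powr q)"
      unfolding fg using \<tau> ts by (rule sm)
    also have "\<dots> \<le> 2 * (a powr q + \<theta> * (2 powr q * H powr q)) + \<epsilon>2 * \<tau> * (L * H powr q)"
      using sq sq' tq \<epsilon>2 \<tau> by (intro add_mono mult_left_mono) (auto simp: L_def distrib_right)
    also have "\<dots> = 2 * a powr q + \<tau> * (\<epsilon>1 * 2 powr q + \<epsilon>2 * L) * H powr q"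
      by (simp add: \<theta>_def algebra_simps)
    also have "\<dots> \<le> 2 * a powr q + \<tau> * (\<epsilon>1 * 2 powr q + \<epsilon>2 * L) * (2 powr q * (a powr q + c powr q))"
      using Hq \<tau> \<epsilon>1 \<epsilon>2 L by (intro add_left_mono mult_left_mono) auto
    also have "\<dots> = 2 * a powr q + \<tau> * (\<epsilon>1 * 4 powr q + \<epsilon>2 * L * 2 powr q) * (a powr q + c powr q)"
      using powr_mult[of 2 2 q] by (simp add: algebra_simps)
    also have "\<dots> \<le> 2 * a powr q + \<tau> * \<epsilon> * (a powr q + c powr q)"
      using \<epsilon>1(3) \<epsilon>2(2) \<tau> by (intro add_left_mono mult_right_mono mult_left_mono) auto
    finally show "f powr q + g powr q \<le> 2 * a powr q + \<epsilon> * \<tau> * (a powr q + c powr q)"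
      by (simp add: mult_ac)
  qed
qed

text \<open>All pointwise inequalities are linear in the powers involved; this is the only form in which they
  are integrated, first over a ball and then over the radius.\<close>

lemma integral_le_linear_combination:
  fixes c f g m :: "'a \<Rightarrow> real"
  assumes int: "integrable M c" "integrable M f" "integrable M g" "integrable M m"
    and le: "\<And>x. c x \<le> \<alpha> * f x + \<beta> * g x + \<gamma> * m x"
  shows "(\<integral>x. c x \<partial>M) \<le> \<alpha> * (\<integral>x. f x \<partial>M) + \<beta> * (\<integral>x. g x \<partial>M) + \<gamma> * (\<integral>x. m x \<partial>M)"
proof -
  have "(\<integral>x. c x \<partial>M) \<le> (\<integral>x. \<alpha> * f x + \<beta> * g x + \<gamma> * m x \<partial>M)"
    using int le by (intro integral_mono) auto
  also have "\<dots> = \<alpha> * (\<integral>x. f x \<partial>M) + \<beta> * (\<integral>x. g x \<partial>M) + \<gamma> * (\<integral>x. m x \<partial>M)"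
    using int by simp
  finally show ?thesis .
qed

section \<open>Masses of balls and the modular\<close>

lemma measurable_ball_powr:
  fixes u :: "real ^ 'n \<Rightarrow> real"
  assumes "u \<in> borel_measurable lebesgue"
  shows "(\<lambda>x. indicator (ball 0 \<rho>) x * \<bar>u x\<bar> powr p) \<in> borel_measurable lebesgue"
  using assms by (intro borel_measurable_times borel_measurable_indicator measurable_abs_powr) auto

text \<open>Measurable functions whose \<open>p\<close>-th power is integrable on every ball about the origin.  Every
  function in the space is of this kind, so its masses are real numbers.\<close>

definition locally_p_integrable :: "real \<Rightarrow> (real ^ 'n \<Rightarrow> real) \<Rightarrow> bool" where
  "locally_p_integrable p u \<longleftrightarrow> u \<in> borel_measurable lebesgue \<and>
     (\<forall>\<rho>. integrable lebesgue (\<lambda>x. indicator (ball 0 \<rho>) x * \<bar>u x\<bar> powr p))"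

text \<open>The mass \<open>h\<^sub>u(\<rho>)\<close> as a real number; it agrees with \<^const>\<open>ball_mass\<close> for locally
  \<open>p\<close>-integrable \<open>u\<close>.\<close>

definition mass :: "real \<Rightarrow> (real ^ 'n \<Rightarrow> real) \<Rightarrow> real \<Rightarrow> real" where
  "mass p u \<rho> = (\<integral>x. indicator (ball 0 \<rho>) x * \<bar>u x\<bar> powr p \<partial>lebesgue)"

text \<open>The weight \<open>\<rho> powr (- b)\<close>, extended by \<open>0\<close> to \<open>\<rho> \<le> 0\<close>.\<close>

definition radial_weight :: "real \<Rightarrow> real \<Rightarrow> real" where
  "radial_weight b \<rho> = indicator {0<..} \<rho> * \<rho> powr (- b)"

text \<open>The \<open>p * q\<close>-th power of the norm of a function in the space, as a Bochner integral.\<close>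

definition modular :: "real \<Rightarrow> real \<Rightarrow> real \<Rightarrow> (real ^ 'n \<Rightarrow> real) \<Rightarrow> real" where
  "modular p q b u = (\<integral>\<rho>. radial_weight b \<rho> * mass p u \<rho> powr q \<partial>lebesgue)"

lemma radial_weight_nonneg [simp]: "0 \<le> radial_weight b \<rho>"
  by (simp add: radial_weight_def)

lemma measurable_radial_weight [measurable]: "radial_weight b \<in> borel_measurable lebesgue"
proof -
  have "radial_weight b \<in> borel_measurable borel"
    unfolding radial_weight_def by measurable
  then show ?thesis
    by (intro measurable_completion) simp
qed

lemma mass_nonneg [simp]: "0 \<le> mass p u \<rho>"
  unfolding mass_def by (intro integral_nonneg_AE) auto

lemma mass_mono:
  assumes "locally_p_integrable p u" "\<rho> \<le> \<sigma>"
  shows "mass p u \<rho> \<le> mass p u \<sigma>"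
  unfolding mass_def using assms
  by (intro integral_mono) (auto simp: locally_p_integrable_def split: split_indicator)

lemma measurable_mass:
  assumes "locally_p_integrable p u"
  shows "mass p u \<in> borel_measurable lebesgue"
proof -
  have "mass p u \<in> borel_measurable borel"
    using assms by (intro borel_measurable_mono monoI mass_mono)
  then show ?thesis
    by (intro measurable_completion) simp
qed

lemma ball_mass_eq_mass:
  assumes "locally_p_integrable p u"
  shows "ball_mass p u \<rho> = ennreal (mass p u \<rho>)"
proof -
  have "ball_mass p u \<rho> = (\<integral>\<^sup>+x. ennreal (indicator (ball 0 \<rho>) x * \<bar>u x\<bar> powr p) \<partial>lebesgue)"
    unfolding ball_mass_def by (intro nn_integral_cong) (auto split: split_indicator)
  also have "\<dots> = ennreal (mass p u \<rho>)"
    unfolding mass_def using assms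
    by (intro nn_integral_eq_integral) (auto simp: locally_p_integrable_def)
  finally show ?thesis .
qed

lemma ball_mass_integrand_eq:
  assumes "locally_p_integrable p u"
  shows "ennreal (\<rho> powr (- b)) * ennreal_powr (ball_mass p u \<rho>) q * indicator {0<..} \<rho>
       = ennreal (radial_weight b \<rho> * mass p u \<rho> powr q)"
  unfolding ball_mass_eq_mass[OF assms]
  by (auto simp: ennreal_powr_def radial_weight_def ennreal_mult split: split_indicator)

lemma ball_mass_integral_eq:
  assumes "locally_p_integrable p u"
  shows "ball_mass_integral p q b u = (\<integral>\<^sup>+\<rho>. ennreal (radial_weight b \<rho> * mass p u \<rho> powr q) \<partial>lebesgue)"
  unfolding ball_mass_integral_def ball_mass_integrand_eq[OF assms] ..

text \<open>Masses increase with the radius: an infinite mass on one ball would make the integrand infinite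
  on an interval of larger radii.\<close>

lemma locally_p_integrable_if_finite:
  fixes u :: "real ^ 'n \<Rightarrow> real"
  assumes u: "u \<in> borel_measurable lebesgue" and fin: "ball_mass_integral p q b u < \<infinity>"
  shows "locally_p_integrable p u"
  unfolding locally_p_integrable_def
proof (intro conjI allI u)
  fix \<rho> :: real
  define R where "R = max \<rho> 1"
  have R: "0 < R" "\<rho> \<le> R" by (auto simp: R_def)
  have "ball_mass p u R < \<infinity>"
  proof (rule ccontr)
    assume "\<not> ball_mass p u R < \<infinity>"
    then have top: "ball_mass p u R = \<infinity>" by (simp add: less_top[symmetric])
    have inf: "ball_mass p u \<sigma> = \<infinity>" if "R \<le> \<sigma>" for \<sigma>
    proof -
      have "ball_mass p u R \<le> ball_mass p u \<sigma>"
        unfolding ball_mass_def using that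
        by (intro nn_integral_mono) (auto split: split_indicator)
      then show ?thesis using top by (simp add: top_unique)
    qed
    have "\<infinity> * emeasure lebesgue {R..R+1} = (\<integral>\<^sup>+\<sigma>. \<infinity> * indicator {R..R+1} \<sigma> \<partial>lebesgue)"
      by (rule nn_integral_cmult_indicator[symmetric]) auto
    also have "\<dots> \<le> ball_mass_integral p q b u"
      unfolding ball_mass_integral_def using R
      by (intro nn_integral_mono)
        (auto simp: inf ennreal_powr_def ennreal_mult_top split: split_indicator)
    finally show False
      using fin by (simp add: top_unique)
  qed
  then have "(\<integral>\<^sup>+x. ennreal (indicator (ball 0 \<rho>) x * \<bar>u x\<bar> powr p) \<partial>lebesgue) < \<infinity>"
    unfolding ball_mass_def using R
    by (elim order.strict_trans1[rotated]) (intro nn_integral_mono, auto split: split_indicator)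
  then show "integrable lebesgue (\<lambda>x. indicator (ball 0 \<rho>) x * \<bar>u x\<bar> powr p)"
    using measurable_ball_powr[OF u] by (intro integrableI_nonneg) auto
qed

lemma ball_mass_functions_iff:
  "u \<in> ball_mass_functions p q b \<longleftrightarrow>
     locally_p_integrable p u \<and> integrable lebesgue (\<lambda>\<rho>. radial_weight b \<rho> * mass p u \<rho> powr q)"
  (is "_ \<longleftrightarrow> ?R")
proof
  assume "u \<in> ball_mass_functions p q b"
  then have u: "u \<in> borel_measurable lebesgue" and fin: "ball_mass_integral p q b u < \<infinity>"
    by (auto simp: ball_mass_functions_def)
  have loc: "locally_p_integrable p u"
    using u fin by (rule locally_p_integrable_if_finite)
  have [measurable]: "mass p u \<in> borel_measurable lebesgue"
    using loc by (rule measurable_mass)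
  show ?R
    using fin loc unfolding ball_mass_integral_eq[OF loc]
    by (auto intro!: integrableI_nonneg)
next
  assume ?R
  then have loc: "locally_p_integrable p u" by simp
  have "(\<integral>\<^sup>+\<rho>. ennreal (radial_weight b \<rho> * mass p u \<rho> powr q) \<partial>lebesgue) = ennreal (modular p q b u)"
    unfolding modular_def using \<open>?R\<close> by (intro nn_integral_eq_integral) auto
  then show "u \<in> ball_mass_functions p q b"
    using loc by (simp add: ball_mass_functions_def ball_mass_integral_eq locally_p_integrable_def)
qed

lemma modular_nonneg [simp]: "0 \<le> modular p q b u"
  unfolding modular_def by (intro integral_nonneg_AE) auto

lemma ball_mass_integral_eq_modular:
  assumes "u \<in> ball_mass_functions p q b"
  shows "ball_mass_integral p q b u = ennreal (modular p q b u)"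
  using assms unfolding ball_mass_functions_iff modular_def
  by (auto simp: ball_mass_integral_eq intro!: nn_integral_eq_integral)

lemma ball_mass_norm_eq_modular:
  assumes "u \<in> ball_mass_functions p q b"
  shows "ball_mass_norm p q b u = modular p q b u powr (1 / (p * q))"
  by (simp add: ball_mass_norm_def ball_mass_integral_eq_modular[OF assms])

lemma ball_mass_functions_measurable:
  "u \<in> ball_mass_functions p q b \<Longrightarrow> u \<in> borel_measurable lebesgue"
  by (simp add: ball_mass_functions_def)

lemma locally_p_integrable_add:
  assumes p: "1 \<le> p" and u: "locally_p_integrable p u" and v: "locally_p_integrable p v"
  shows "locally_p_integrable p (\<lambda>x. u x + v x)"
  unfolding locally_p_integrable_def
proof (intro conjI allI)
  have [measurable]: "u \<in> borel_measurable lebesgue" "v \<in> borel_measurable lebesgue"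
    using u v by (auto simp: locally_p_integrable_def)
  show "(\<lambda>x. u x + v x) \<in> borel_measurable lebesgue" by measurable
  fix \<rho>
  show "integrable lebesgue (\<lambda>x. indicator (ball 0 \<rho>) x * \<bar>u x + v x\<bar> powr p)"
  proof (rule Bochner_Integration.integrable_bound)
    show "integrable lebesgue (\<lambda>x. 2 powr p * (indicator (ball 0 \<rho>) x * \<bar>u x\<bar> powr p
        + indicator (ball 0 \<rho>) x * \<bar>v x\<bar> powr p))"
      using u v by (auto simp: locally_p_integrable_def)
    show "AE x in lebesgue. norm (indicator (ball 0 \<rho>) x * \<bar>u x + v x\<bar> powr p)
        \<le> norm (2 powr p * (indicator (ball 0 \<rho>) x * \<bar>u x\<bar> powr p
        + indicator (ball 0 \<rho>) x * \<bar>v x\<bar> powr p))"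
      using abs_powr_add_le[OF p] by (auto split: split_indicator)
    show "(\<lambda>x. indicator (ball 0 \<rho>) x * \<bar>u x + v x\<bar> powr p) \<in> borel_measurable lebesgue"
      by (intro measurable_ball_powr) measurable
  qed
qed

lemma locally_p_integrable_scale:
  assumes "locally_p_integrable p u"
  shows "locally_p_integrable p (\<lambda>x. c * u x)"
proof -
  have "(\<lambda>x. indicator (ball 0 \<rho>) x * \<bar>c * u x\<bar> powr p)
      = (\<lambda>x. \<bar>c\<bar> powr p * (indicator (ball 0 \<rho>) x * \<bar>u x\<bar> powr p))" for \<rho>
    by (simp add: abs_mult powr_mult mult_ac)
  then show ?thesis
    using assms by (auto simp: locally_p_integrable_def)
qed

lemma mass_scale: "mass p (\<lambda>x. c * u x) \<rho> = \<bar>c\<bar> powr p * mass p u \<rho>"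
proof -
  have "(\<lambda>x. indicator (ball 0 \<rho>) x * \<bar>c * u x\<bar> powr p)
      = (\<lambda>x. \<bar>c\<bar> powr p * (indicator (ball 0 \<rho>) x * \<bar>u x\<bar> powr p))"
    by (simp add: abs_mult powr_mult mult_ac)
  then show ?thesis by (simp add: mass_def)
qed

lemma mass_le_linear_combination:
  fixes c f g m :: "real ^ 'n \<Rightarrow> real"
  assumes loc: "locally_p_integrable p c" "locally_p_integrable p f" "locally_p_integrable p g" "locally_p_integrable p m"
    and le: "\<And>x. \<bar>c x\<bar> powr p \<le> \<alpha> * \<bar>f x\<bar> powr p + \<beta> * \<bar>g x\<bar> powr p + \<gamma> * \<bar>m x\<bar> powr p"
  shows "mass p c \<rho> \<le> \<alpha> * mass p f \<rho> + \<beta> * mass p g \<rho> + \<gamma> * mass p m \<rho>"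
  unfolding mass_def using loc le
  by (intro integral_le_linear_combination) (auto simp: locally_p_integrable_def split: split_indicator)

lemma modular_le_linear_combination:
  fixes c f g m :: "real ^ 'n \<Rightarrow> real"
  assumes mem: "c \<in> ball_mass_functions p q b" "f \<in> ball_mass_functions p q b"
      "g \<in> ball_mass_functions p q b" "m \<in> ball_mass_functions p q b"
    and le: "\<And>\<rho>. mass p c \<rho> powr q \<le> \<alpha> * mass p f \<rho> powr q + \<beta> * mass p g \<rho> powr q + \<gamma> * mass p m \<rho> powr q"
  shows "modular p q b c \<le> \<alpha> * modular p q b f + \<beta> * modular p q b g + \<gamma> * modular p q b m"
  unfolding modular_def
proof (rule integral_le_linear_combination)
  fix \<rho>
  show "radial_weight b \<rho> * mass p c \<rho> powr q \<le> \<alpha> * (radial_weight b \<rho> * mass p f \<rho> powr q)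
      + \<beta> * (radial_weight b \<rho> * mass p g \<rho> powr q) + \<gamma> * (radial_weight b \<rho> * mass p m \<rho> powr q)"
    using mult_left_mono[OF le[of \<rho>] radial_weight_nonneg[of b \<rho>]] by (simp add: algebra_simps)
qed (use mem in \<open>auto simp: ball_mass_functions_iff\<close>)

lemma modular_scale:
  "modular p q b (\<lambda>x. c * u x) = \<bar>c\<bar> powr (p * q) * modular p q b u"
proof -
  have "(\<lambda>\<rho>. radial_weight b \<rho> * mass p (\<lambda>x. c * u x) \<rho> powr q)
      = (\<lambda>\<rho>. \<bar>c\<bar> powr (p * q) * (radial_weight b \<rho> * mass p u \<rho> powr q))"
    by (simp add: mass_scale powr_mult powr_powr mult_ac)
  then show ?thesis by (simp add: modular_def)
qed

lemma ball_mass_functions_scale: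
  assumes "u \<in> ball_mass_functions p q b"
  shows "(\<lambda>x. c * u x) \<in> ball_mass_functions p q b"
proof -
  have "(\<lambda>\<rho>. radial_weight b \<rho> * mass p (\<lambda>x. c * u x) \<rho> powr q)
      = (\<lambda>\<rho>. \<bar>c\<bar> powr (p * q) * (radial_weight b \<rho> * mass p u \<rho> powr q))"
    by (simp add: mass_scale powr_mult powr_powr mult_ac)
  then show ?thesis
    using assms by (simp add: ball_mass_functions_iff locally_p_integrable_scale)
qed

lemma mass_add_le:
  assumes p: "1 \<le> p" and u: "locally_p_integrable p u" and v: "locally_p_integrable p v"
  shows "mass p (\<lambda>x. u x + v x) \<rho> \<le> 2 powr p * (mass p u \<rho> + mass p v \<rho>)"
  using mass_le_linear_combination[OF locally_p_integrable_add[OF p u v] u v v, of "2 powr p" "2 powr p" 0 \<rho>]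
    abs_powr_add_le[OF p]
  by (simp add: distrib_left)

lemma ball_mass_functions_add:
  assumes p: "1 \<le> p" and q: "1 \<le> q"
    and u: "u \<in> ball_mass_functions p q b" and v: "v \<in> ball_mass_functions p q b"
  shows "(\<lambda>x. u x + v x) \<in> ball_mass_functions p q b"
  unfolding ball_mass_functions_iff
proof
  have loc: "locally_p_integrable p u" "locally_p_integrable p v"
    and int: "integrable lebesgue (\<lambda>\<rho>. radial_weight b \<rho> * mass p u \<rho> powr q)"
      "integrable lebesgue (\<lambda>\<rho>. radial_weight b \<rho> * mass p v \<rho> powr q)"
    using u v by (auto simp: ball_mass_functions_iff)
  show loc': "locally_p_integrable p (\<lambda>x. u x + v x)"
    using p loc by (rule locally_p_integrable_add)
  define A where "A = (2 powr p) powr q * 2 powr q"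
  have le: "radial_weight b \<rho> * mass p (\<lambda>x. u x + v x) \<rho> powr q
      \<le> A * (radial_weight b \<rho> * mass p u \<rho> powr q + radial_weight b \<rho> * mass p v \<rho> powr q)" for \<rho>
  proof -
    have "mass p (\<lambda>x. u x + v x) \<rho> powr q \<le> (2 powr p * (mass p u \<rho> + mass p v \<rho>)) powr q"
      using q mass_add_le[OF p loc] by (intro powr_mono2) auto
    also have "\<dots> = (2 powr p) powr q * (mass p u \<rho> + mass p v \<rho>) powr q"
      by (rule powr_mult)
    also have "\<dots> \<le> (2 powr p) powr q * (2 powr q * (mass p u \<rho> powr q + mass p v \<rho> powr q))"
      by (intro mult_left_mono powr_add_le q) auto
    finally show ?thesis
      using mult_left_mono[OF _ radial_weight_nonneg[of b \<rho>]] by (fastforce simp: A_def algebra_simps)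
  qed
  show "integrable lebesgue (\<lambda>\<rho>. radial_weight b \<rho> * mass p (\<lambda>x. u x + v x) \<rho> powr q)"
  proof (rule Bochner_Integration.integrable_bound)
    show "integrable lebesgue (\<lambda>\<rho>. A * (radial_weight b \<rho> * mass p u \<rho> powr q + radial_weight b \<rho> * mass p v \<rho> powr q))"
      using int by auto
    show "(\<lambda>\<rho>. radial_weight b \<rho> * mass p (\<lambda>x. u x + v x) \<rho> powr q) \<in> borel_measurable lebesgue"
      using measurable_mass[OF loc'] by measurable
    show "AE \<rho> in lebesgue. norm (radial_weight b \<rho> * mass p (\<lambda>x. u x + v x) \<rho> powr q)
        \<le> norm (A * (radial_weight b \<rho> * mass p u \<rho> powr q + radial_weight b \<rho> * mass p v \<rho> powr q))"
      using le by (auto simp: A_def)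
  qed
qed

lemma ball_mass_functions_diff:
  assumes "1 \<le> p" "1 \<le> q" "u \<in> ball_mass_functions p q b" "v \<in> ball_mass_functions p q b"
  shows "(\<lambda>x. u x - v x) \<in> ball_mass_functions p q b"
  using ball_mass_functions_add[OF assms(1,2,3) ball_mass_functions_scale[OF assms(4), of "-1"]] by simp

lemma ball_mass_functions_zero: "(\<lambda>x. 0) \<in> ball_mass_functions p q b"
  by (simp add: ball_mass_functions_iff locally_p_integrable_def mass_def)

lemma ball_mass_functions_locally_p_integrable: "u \<in> ball_mass_functions p q b \<Longrightarrow> locally_p_integrable p u"
  by (simp add: ball_mass_functions_iff)

lemma mass_convex:
  assumes p: "1 \<le> p" and u: "locally_p_integrable p u" and v: "locally_p_integrable p v"
    and t: "0 \<le> t" "t \<le> 1"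
  shows "mass p (\<lambda>x. (1 - t) * u x + t * v x) \<rho> \<le> (1 - t) * mass p u \<rho> + t * mass p v \<rho>"
  using mass_le_linear_combination[OF locally_p_integrable_add[OF p locally_p_integrable_scale[OF u] locally_p_integrable_scale[OF v]]
      u v v, of "1 - t" t "1 - t" t 0 \<rho>] abs_powr_convex[OF p t]
  by simp

lemma modular_convex:
  assumes p: "1 \<le> p" and q: "1 \<le> q"
    and u: "u \<in> ball_mass_functions p q b" and v: "v \<in> ball_mass_functions p q b"
    and t: "0 \<le> t" "t \<le> 1"
  shows "modular p q b (\<lambda>x. (1 - t) * u x + t * v x) \<le> (1 - t) * modular p q b u + t * modular p q b v"
proof -
  have "mass p (\<lambda>x. (1 - t) * u x + t * v x) \<rho> powr q
      \<le> (1 - t) * mass p u \<rho> powr q + t * mass p v \<rho> powr q" for \<rho>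
  proof -
    have "mass p (\<lambda>x. (1 - t) * u x + t * v x) \<rho> powr q \<le> ((1 - t) * mass p u \<rho> + t * mass p v \<rho>) powr q"
      using mass_convex[OF p ball_mass_functions_locally_p_integrable[OF u] ball_mass_functions_locally_p_integrable[OF v] t] q
      by (intro powr_mono2) auto
    also have "\<dots> \<le> (1 - t) * mass p u \<rho> powr q + t * mass p v \<rho> powr q"
      using abs_powr_convex[OF q t, of "mass p u \<rho>" "mass p v \<rho>"] t by simp
    finally show ?thesis .
  qed
  then show ?thesis
    using modular_le_linear_combination[OF ball_mass_functions_add[OF p q ball_mass_functions_scale[OF u]
        ball_mass_functions_scale[OF v]] u v v, of "1 - t" t "1 - t" t 0]
    by simp
qed

section \<open>Uniform convexity and uniform smoothness of the modular\<close>

lemma modular_uniformly_convex: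
  fixes p q b \<epsilon> :: real
  assumes p: "1 < p" and q: "1 \<le> q" and \<epsilon>: "0 < \<epsilon>"
  obtains C where "0 < C"
    and "\<And>u v :: real ^ 'n \<Rightarrow> real. u \<in> ball_mass_functions p q b \<Longrightarrow> v \<in> ball_mass_functions p q b \<Longrightarrow>
      modular p q b (\<lambda>x. u x - v x) \<le> \<epsilon> * (modular p q b u + modular p q b v)
        + C * ((modular p q b u + modular p q b v) / 2 - modular p q b (\<lambda>x. (u x + v x) / 2))"
proof -
  \<comment> \<open>Chosen so that raising the inequality for the masses to the power \<open>q\<close> yields \<open>\<epsilon>\<close>.\<close>
  define \<epsilon>' where "\<epsilon>' = \<epsilon> powr (1 / q) / 4"
  have \<epsilon>': "0 < \<epsilon>'" "(4 * \<epsilon>') powr q = \<epsilon>"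
    using \<epsilon> q by (auto simp: \<epsilon>'_def powr_powr)
  obtain C0 where C0: "0 \<le> C0"
    and sc: "\<And>s t :: real. \<bar>s - t\<bar> powr p \<le> \<epsilon>' * (\<bar>s\<bar> powr p + \<bar>t\<bar> powr p)
           + C0 * ((\<bar>s\<bar> powr p + \<bar>t\<bar> powr p) / 2 - \<bar>(s + t) / 2\<bar> powr p)"
    using abs_powr_uniformly_convex[OF p \<epsilon>'(1)] by blast
  have p1: "1 \<le> p" using p by simp
  define C where "C = C0 + 1"
  have C: "0 < C" "C0 \<le> C" using C0 by (auto simp: C_def)
  have mid_le: "\<bar>(s + t) / 2\<bar> powr p \<le> (\<bar>s\<bar> powr p + \<bar>t\<bar> powr p) / 2" for s t :: real
    using abs_powr_convex[OF p1, of "1/2" s t] by (simp add: field_simps)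
  have regroup: "e * (f + g) + c * ((f + g) / 2 - m) = (e + c / 2) * f + (e + c / 2) * g + (- c) * m"
    for e c f g m :: real
    by (simp add: field_simps)
  have sc': "\<bar>s - t\<bar> powr p \<le> (\<epsilon>' + C / 2) * \<bar>s\<bar> powr p + (\<epsilon>' + C / 2) * \<bar>t\<bar> powr p + (- C) * \<bar>(s + t) / 2\<bar> powr p"
    for s t :: real
  proof -
    have "\<bar>s - t\<bar> powr p \<le> \<epsilon>' * (\<bar>s\<bar> powr p + \<bar>t\<bar> powr p)
        + C0 * ((\<bar>s\<bar> powr p + \<bar>t\<bar> powr p) / 2 - \<bar>(s + t) / 2\<bar> powr p)"
      by (rule sc)
    also have "\<dots> \<le> \<epsilon>' * (\<bar>s\<bar> powr p + \<bar>t\<bar> powr p)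
        + C * ((\<bar>s\<bar> powr p + \<bar>t\<bar> powr p) / 2 - \<bar>(s + t) / 2\<bar> powr p)"
      using C(2) mid_le[of s t] by (intro add_left_mono mult_right_mono) auto
    also have "\<dots> = (\<epsilon>' + C / 2) * \<bar>s\<bar> powr p + (\<epsilon>' + C / 2) * \<bar>t\<bar> powr p
        + (- C) * \<bar>(s + t) / 2\<bar> powr p"
      by (rule regroup)
    finally show ?thesis .
  qed
  show ?thesis
  proof (rule that)
    show "0 < (2 * C) powr q" using C by simp
    fix u v :: "real ^ 'n \<Rightarrow> real"
    assume u: "u \<in> ball_mass_functions p q b" and v: "v \<in> ball_mass_functions p q b"
    let ?d = "\<lambda>x. u x - v x" and ?m = "\<lambda>x. (u x + v x) / 2"
    have d: "?d \<in> ball_mass_functions p q b"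
      using p1 q u v by (rule ball_mass_functions_diff)
    have m: "?m \<in> ball_mass_functions p q b"
      using ball_mass_functions_scale[OF ball_mass_functions_add[OF p1 q u v], of "1/2"] by simp
    note loc = ball_mass_functions_locally_p_integrable[OF u] ball_mass_functions_locally_p_integrable[OF v]
      ball_mass_functions_locally_p_integrable[OF d] ball_mass_functions_locally_p_integrable[OF m]
    have "mass p ?d \<rho> powr q \<le> (\<epsilon> + (2 * C) powr q / 2) * mass p u \<rho> powr q
        + (\<epsilon> + (2 * C) powr q / 2) * mass p v \<rho> powr q + (- ((2 * C) powr q)) * mass p ?m \<rho> powr q" for \<rho>
    proof -
      have "mass p ?d \<rho> \<le> \<epsilon>' * (mass p u \<rho> + mass p v \<rho>)
          + C * ((mass p u \<rho> + mass p v \<rho>) / 2 - mass p ?m \<rho>)"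
        using mass_le_linear_combination[OF loc(3,1,2,4) sc', of \<rho>] by (simp only: regroup)
      moreover have "mass p ?m \<rho> \<le> (mass p u \<rho> + mass p v \<rho>) / 2"
        using mass_convex[OF p1 loc(1,2), of "1/2" \<rho>] by (simp add: field_simps)
      ultimately have "mass p ?d \<rho> powr q \<le> (4 * \<epsilon>') powr q * (mass p u \<rho> powr q + mass p v \<rho> powr q)
          + (2 * C) powr q * ((mass p u \<rho> powr q + mass p v \<rho> powr q) / 2 - mass p ?m \<rho> powr q)"
        using q \<epsilon>' C by (intro powr_uniformly_convex_step) auto
      then show ?thesis
        by (simp only: \<epsilon>'(2) regroup)
    qed
    from modular_le_linear_combination[OF d u v m this]
    show "modular p q b ?d \<le> \<epsilon> * (modular p q b u + modular p q b v)
        + (2 * C) powr q * ((modular p q b u + modular p q b v) / 2 - modular p q b ?m)"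
      by (simp only: regroup)
  qed
qed

lemma mass_perturb_le:
  assumes p: "1 \<le> p" and u: "locally_p_integrable p u" and v: "locally_p_integrable p v"
    and t: "0 \<le> t" "t \<le> 1"
  shows "mass p (\<lambda>x. u x + t * v x) \<rho> \<le> mass p u \<rho> + 2 powr p * t * (mass p u \<rho> + mass p v \<rho>)"
proof -
  have "mass p (\<lambda>x. u x + t * v x) \<rho> = mass p (\<lambda>x. (1 - t) * u x + t * (u x + v x)) \<rho>"
    by (simp add: algebra_simps)
  also have "\<dots> \<le> (1 - t) * mass p u \<rho> + t * mass p (\<lambda>x. u x + v x) \<rho>"
    using p u locally_p_integrable_add[OF p u v] t by (rule mass_convex)
  also have "\<dots> \<le> mass p u \<rho> + t * (2 powr p * (mass p u \<rho> + mass p v \<rho>))"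
    using mass_add_le[OF p u v] t by (intro add_mono mult_left_mono) (auto simp: mult_left_le_one_le)
  finally show ?thesis by (simp add: mult_ac)
qed

lemma modular_uniformly_smooth:
  fixes p q b \<epsilon> :: real
  assumes p: "1 < p" and q: "1 \<le> q" and \<epsilon>: "0 < \<epsilon>"
  obtains \<delta> where "0 < \<delta>" "\<delta> \<le> 1"
    and "\<And>\<tau> (u :: real ^ 'n \<Rightarrow> real) w. 0 < \<tau> \<Longrightarrow> \<tau> \<le> \<delta> \<Longrightarrow>
      u \<in> ball_mass_functions p q b \<Longrightarrow> w \<in> ball_mass_functions p q b \<Longrightarrow>
      modular p q b (\<lambda>x. u x + \<tau> * w x) + modular p q b (\<lambda>x. u x - \<tau> * w x)
        \<le> 2 * modular p q b u + \<epsilon> * \<tau> * (modular p q b u + modular p q b w)"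
proof -
  have p1: "1 \<le> p" using p by simp
  define K where "K = 2 * 2 powr p"
  have K: "0 \<le> K" by (simp add: K_def)
  obtain \<epsilon>1 \<delta>1 where \<epsilon>1: "0 < \<epsilon>1" and \<delta>1: "0 < \<delta>1" "\<delta>1 \<le> 1"
    and step: "\<And>\<tau> a c f g :: real. 0 < \<tau> \<Longrightarrow> \<tau> \<le> \<delta>1 \<Longrightarrow> 0 \<le> a \<Longrightarrow> 0 \<le> c \<Longrightarrow> 0 \<le> f \<Longrightarrow> 0 \<le> g \<Longrightarrow>
       f + g \<le> 2 * a + \<epsilon>1 * \<tau> * (a + c) \<Longrightarrow> \<bar>f - g\<bar> \<le> K * \<tau> * (a + c) \<Longrightarrow>
       f powr q + g powr q \<le> 2 * a powr q + \<epsilon> * \<tau> * (a powr q + c powr q)"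
    using powr_uniformly_smooth_step[OF q \<epsilon> K] by blast
  obtain \<delta>2 where \<delta>2: "0 < \<delta>2" "\<delta>2 \<le> 1"
    and sc: "\<And>\<tau> s t :: real. 0 < \<tau> \<Longrightarrow> \<tau> \<le> \<delta>2 \<Longrightarrow>
       \<bar>s + \<tau> * t\<bar> powr p + \<bar>s - \<tau> * t\<bar> powr p \<le> 2 * \<bar>s\<bar> powr p + \<epsilon>1 * \<tau> * (\<bar>s\<bar> powr p + \<bar>t\<bar> powr p)"
    using abs_powr_uniformly_smooth[OF p \<epsilon>1] by blast
  show ?thesis
  proof (rule that)
    show "0 < min \<delta>1 \<delta>2" "min \<delta>1 \<delta>2 \<le> 1" using \<delta>1 \<delta>2 by auto
    fix \<tau> and u w :: "real ^ 'n \<Rightarrow> real"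
    assume \<tau>: "0 < \<tau>" "\<tau> \<le> min \<delta>1 \<delta>2"
      and u: "u \<in> ball_mass_functions p q b" and w: "w \<in> ball_mass_functions p q b"
    have \<tau>1: "0 \<le> \<tau>" "\<tau> \<le> 1" using \<tau> \<delta>1 by auto
    let ?f = "\<lambda>x. u x + \<tau> * w x" and ?g = "\<lambda>x. u x - \<tau> * w x"
    have f: "?f \<in> ball_mass_functions p q b" and g: "?g \<in> ball_mass_functions p q b"
      using ball_mass_functions_add[OF p1 q u ball_mass_functions_scale[OF w]]
        ball_mass_functions_diff[OF p1 q u ball_mass_functions_scale[OF w]] by auto
    note loc = ball_mass_functions_locally_p_integrable[OF u] ball_mass_functions_locally_p_integrable[OF w]
      ball_mass_functions_locally_p_integrable[OF f] ball_mass_functions_locally_p_integrable[OF g]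
    have "mass p ?f \<rho> powr q \<le> (2 + \<epsilon> * \<tau>) * mass p u \<rho> powr q + (\<epsilon> * \<tau>) * mass p w \<rho> powr q
        + (- 1) * mass p ?g \<rho> powr q" for \<rho>
    proof -
      have "mass p ?f \<rho> \<le> (2 + \<epsilon>1 * \<tau>) * mass p u \<rho> + (\<epsilon>1 * \<tau>) * mass p w \<rho> + (- 1) * mass p ?g \<rho>"
      proof (rule mass_le_linear_combination[OF loc(3,1,2,4)])
        fix x
        show "\<bar>?f x\<bar> powr p \<le> (2 + \<epsilon>1 * \<tau>) * \<bar>u x\<bar> powr p + (\<epsilon>1 * \<tau>) * \<bar>w x\<bar> powr p + (- 1) * \<bar>?g x\<bar> powr p"
          using sc[of \<tau> "u x" "w x"] \<tau> by (simp add: algebra_simps)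
      qed
      then have sum: "mass p ?f \<rho> + mass p ?g \<rho> \<le> 2 * mass p u \<rho> + \<epsilon>1 * \<tau> * (mass p u \<rho> + mass p w \<rho>)"
        by (simp add: algebra_simps)
      have "mass p u \<rho> = mass p (\<lambda>x. (1 - 1/2) * ?f x + 1/2 * ?g x) \<rho>"
        by (simp add: field_simps)
      also have "\<dots> \<le> (1 - 1/2) * mass p ?f \<rho> + 1/2 * mass p ?g \<rho>"
        using p1 loc by (intro mass_convex) auto
      finally have mid: "2 * mass p u \<rho> \<le> mass p ?f \<rho> + mass p ?g \<rho>" by simp
      have "mass p ?f \<rho> \<le> mass p u \<rho> + 2 powr p * \<tau> * (mass p u \<rho> + mass p w \<rho>)"
        using p1 loc(1,2) \<tau>1 by (rule mass_perturb_le)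
      moreover have "mass p ?g \<rho> \<le> mass p u \<rho> + 2 powr p * \<tau> * (mass p u \<rho> + mass p w \<rho>)"
        using mass_perturb_le[OF p1 loc(1) locally_p_integrable_scale[OF loc(2), of "-1"] \<tau>1, of \<rho>]
          mass_scale[of p "-1" w \<rho>] by simp
      ultimately have dif: "\<bar>mass p ?f \<rho> - mass p ?g \<rho>\<bar> \<le> K * \<tau> * (mass p u \<rho> + mass p w \<rho>)"
        using mid unfolding K_def abs_le_iff mult.assoc[of 2] by linarith
      show ?thesis
        using step[OF _ _ _ _ _ _ sum dif] \<tau> by (simp add: algebra_simps)
    qed
    from modular_le_linear_combination[OF f u w g this]
    show "modular p q b ?f + modular p q b ?g
        \<le> 2 * modular p q b u + \<epsilon> * \<tau> * (modular p q b u + modular p q b w)"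
      by (simp add: algebra_simps)
  qed
qed

section \<open>Completeness with respect to the modular\<close>

lemma ennreal_powr_mono:
  assumes "0 < s" "x \<le> y"
  shows "ennreal_powr x s \<le> ennreal_powr y s"
proof (cases "y = \<infinity>")
  case False
  then have "x \<noteq> \<infinity>" using assms(2) by (auto simp: top_unique)
  have "enn2real x \<le> enn2real y"
    using assms(2) False by (intro enn2real_mono) (auto simp: less_top)
  then show ?thesis
    using False \<open>x \<noteq> \<infinity>\<close> assms(1)
    by (auto simp: ennreal_powr_def intro!: ennreal_leI powr_mono2)
qed (simp add: ennreal_powr_def)

text \<open>A monotone surjection from a linear order onto a densely ordered one is continuous.\<close>

lemma continuous_on_ennreal_powr:
  assumes s: "0 < s"
  shows "continuous_on A (\<lambda>x. ennreal_powr x s)"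
proof -
  have "surj (\<lambda>x. ennreal_powr x s)"
  proof (rule surjI)
    fix y :: ennreal
    show "ennreal_powr (ennreal_powr y (1 / s)) s = y"
      using s by (cases y) (auto simp: ennreal_powr_def powr_powr)
  qed
  then have "continuous_on UNIV (\<lambda>x. ennreal_powr x s)"
    using ennreal_powr_mono[OF s] by (intro continuous_onI_mono) auto
  then show ?thesis by (rule continuous_on_subset) simp
qed

lemma ball_mass_liminf:
  fixes v :: "nat \<Rightarrow> real ^ 'n \<Rightarrow> real"
  assumes meas: "\<And>k. v k \<in> borel_measurable lebesgue"
    and p: "0 < p" and lim: "AE x in lebesgue. (\<lambda>k. v k x) \<longlonglongrightarrow> w x"
  shows "ball_mass p w \<rho> \<le> liminf (\<lambda>k. ball_mass p (v k) \<rho>)"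
proof -
  have "ball_mass p w \<rho>
      \<le> (\<integral>\<^sup>+x. liminf (\<lambda>k. ennreal (\<bar>v k x\<bar> powr p) * indicator (ball 0 \<rho>) x) \<partial>lebesgue)"
    unfolding ball_mass_def
  proof (intro nn_integral_mono_AE, use lim in eventually_elim)
    fix x assume "(\<lambda>k. v k x) \<longlonglongrightarrow> w x"
    then have "(\<lambda>k. \<bar>v k x\<bar> powr p) \<longlonglongrightarrow> \<bar>w x\<bar> powr p"
      using p by (intro tendsto_powr2 tendsto_rabs) auto
    then have "(\<lambda>k. ennreal (\<bar>v k x\<bar> powr p) * indicator (ball 0 \<rho>) x)
        \<longlonglongrightarrow> ennreal (\<bar>w x\<bar> powr p) * indicator (ball 0 \<rho>) x"
      by (auto split: split_indicator)
    from lim_imp_Liminf[OF _ this]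
    show "ennreal (\<bar>w x\<bar> powr p) * indicator (ball 0 \<rho>) x
        \<le> liminf (\<lambda>k. ennreal (\<bar>v k x\<bar> powr p) * indicator (ball 0 \<rho>) x)"
      by simp
  qed
  also have "\<dots> \<le> liminf (\<lambda>k. ball_mass p (v k) \<rho>)"
    unfolding ball_mass_def using meas
    by (intro nn_integral_liminf borel_measurable_times_ennreal borel_measurable_indicator
        measurable_compose[OF _ measurable_ennreal] measurable_abs_powr) auto
  finally show ?thesis .
qed

text \<open>Lower semicontinuity under almost everywhere convergence, by Fatou's lemma over each ball and
  once more over the radius.\<close>

lemma ball_mass_integral_liminf:
  fixes v :: "nat \<Rightarrow> real ^ 'n \<Rightarrow> real"
  assumes mem: "\<And>k. v k \<in> ball_mass_functions p q b"
    and p: "0 < p" and q: "0 < q" and lim: "AE x in lebesgue. (\<lambda>k. v k x) \<longlonglongrightarrow> w x"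
  shows "ball_mass_integral p q b w \<le> liminf (\<lambda>k. ball_mass_integral p q b (v k))"
proof -
  \<comment> \<open>The integrand at radius \<open>\<rho>\<close> as a function of the mass: monotone and continuous, so that it
    commutes with the limit inferior.\<close>
  define \<Theta> where "\<Theta> \<rho> a = ennreal (\<rho> powr (- b)) * indicator {0<..} \<rho> * ennreal_powr a q" for \<rho> a
  have bmi: "ball_mass_integral p q b u = (\<integral>\<^sup>+\<rho>. \<Theta> \<rho> (ball_mass p u \<rho>) \<partial>lebesgue)" for u :: "real ^ 'n \<Rightarrow> real"
    unfolding ball_mass_integral_def \<Theta>_def by (simp add: mult_ac)
  have mono: "mono (\<Theta> \<rho>)" for \<rho>
    unfolding \<Theta>_def by (intro monoI mult_left_mono ennreal_powr_mono q) auto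
  have cont: "continuous_on UNIV (\<Theta> \<rho>)" for \<rho>
    unfolding \<Theta>_def
    by (intro ennreal_continuous_on_cmult continuous_on_ennreal_powr q) (auto split: split_indicator)
  have meas: "(\<lambda>\<rho>. \<Theta> \<rho> (ball_mass p (v k) \<rho>)) \<in> borel_measurable lebesgue" for k
  proof -
    have loc: "locally_p_integrable p (v k)"
      using mem by (rule ball_mass_functions_locally_p_integrable)
    have "(\<lambda>\<rho>. \<Theta> \<rho> (ball_mass p (v k) \<rho>)) = (\<lambda>\<rho>. ennreal (radial_weight b \<rho> * mass p (v k) \<rho> powr q))"
      using ball_mass_integrand_eq[OF loc, of _ b q] by (simp add: \<Theta>_def mult_ac)
    then show ?thesis
      using measurable_mass[OF loc] by simp
  qed
  have "ball_mass_integral p q b w \<le> (\<integral>\<^sup>+\<rho>. liminf (\<lambda>k. \<Theta> \<rho> (ball_mass p (v k) \<rho>)) \<partial>lebesgue)"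
    unfolding bmi
  proof (rule nn_integral_mono)
    fix \<rho> :: real
    have "\<Theta> \<rho> (ball_mass p w \<rho>) \<le> \<Theta> \<rho> (liminf (\<lambda>k. ball_mass p (v k) \<rho>))"
      using mem p lim by (intro monoD[OF mono] ball_mass_liminf) (auto intro: ball_mass_functions_measurable)
    also have "\<dots> = liminf (\<lambda>k. \<Theta> \<rho> (ball_mass p (v k) \<rho>))"
      by (rule Liminf_compose_continuous_mono[OF cont mono, symmetric]) simp
    finally show "\<Theta> \<rho> (ball_mass p w \<rho>) \<le> liminf (\<lambda>k. \<Theta> \<rho> (ball_mass p (v k) \<rho>))" .
  qed
  also have "\<dots> \<le> liminf (\<lambda>k. ball_mass_integral p q b (v k))"
    unfolding bmi by (intro nn_integral_liminf meas)
  finally show ?thesis .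
qed

text \<open>The integral over the radii in \<open>{R..R+1}\<close> already bounds the mass on the ball of radius \<open>R\<close>.\<close>

lemma mass_powr_le_modular:
  assumes u: "u \<in> ball_mass_functions p q b" and R: "0 < R" and b: "0 \<le> b" and q: "0 \<le> q"
  shows "mass p u R powr q * (R + 1) powr (- b) \<le> modular p q b u"
proof -
  have "mass p u R powr q * (R + 1) powr (- b)
      = (\<integral>\<rho>. indicator {R..R+1} \<rho> * (mass p u R powr q * (R + 1) powr (- b)) \<partial>lebesgue)"
    by simp
  also have "\<dots> \<le> modular p q b u"
    unfolding modular_def
  proof (rule integral_mono)
    show "integrable lebesgue (\<lambda>\<rho>. indicator {R..R+1} \<rho> * (mass p u R powr q * (R + 1) powr (- b)))"
      by (intro integrable_mult_left) simp
    show "integrable lebesgue (\<lambda>\<rho>. radial_weight b \<rho> * mass p u \<rho> powr q)"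
      using u by (simp add: ball_mass_functions_iff)
    fix \<rho>
    show "indicator {R..R+1} \<rho> * (mass p u R powr q * (R + 1) powr (- b)) \<le> radial_weight b \<rho> * mass p u \<rho> powr q"
    proof (cases "\<rho> \<in> {R..R+1}")
      case True
      have "mass p u R powr q \<le> mass p u \<rho> powr q"
        using True q mass_mono[OF ball_mass_functions_locally_p_integrable[OF u], of R \<rho>] by (intro powr_mono2) auto
      moreover have "(R + 1) powr (- b) \<le> \<rho> powr (- b)"
        using True R b by (intro powr_mono2') auto
      ultimately have "mass p u R powr q * (R + 1) powr (- b) \<le> mass p u \<rho> powr q * \<rho> powr (- b)"
        by (intro mult_mono) auto
      then show ?thesis
        using True R by (simp add: radial_weight_def mult.commute)
    qed auto
  qed
  finally show ?thesis .
qed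

lemma mass_le_modular:
  assumes u: "u \<in> ball_mass_functions p q b" and R: "0 < R" and b: "0 \<le> b" and q: "0 < q"
  shows "mass p u R \<le> (modular p q b u * (R + 1) powr b) powr (1 / q)"
proof -
  have "mass p u R powr q \<le> modular p q b u * (R + 1) powr b"
    using mass_powr_le_modular[OF u R b less_imp_le[OF q]] R by (simp add: powr_minus field_simps)
  then have "(mass p u R powr q) powr (1 / q) \<le> (modular p q b u * (R + 1) powr b) powr (1 / q)"
    using q by (intro powr_mono2) auto
  then show ?thesis
    using q by (simp add: powr_powr)
qed

lemma AE_zero_if_modular_zero:
  assumes u: "u \<in> ball_mass_functions p q b" and b: "0 \<le> b" and q: "0 < q"
    and zero: "modular p q b u = 0"
  shows "AE x in lebesgue. u x = 0"
proof -
  have "AE x in lebesgue. indicator (ball 0 (real (Suc n))) x * \<bar>u x\<bar> powr p = 0" for n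
  proof -
    have "mass p u (real (Suc n)) \<le> 0"
      using mass_le_modular[OF u _ b q, of "real (Suc n)"] zero by simp
    then have "mass p u (real (Suc n)) = 0"
      by (intro antisym mass_nonneg)
    then show ?thesis
      using ball_mass_functions_locally_p_integrable[OF u] unfolding mass_def locally_p_integrable_def
      by (subst (asm) integral_nonneg_eq_0_iff_AE) auto
  qed
  then have "AE x in lebesgue. \<forall>n. indicator (ball 0 (real (Suc n))) x * \<bar>u x\<bar> powr p = 0"
    unfolding AE_all_countable by (rule allI)
  then show ?thesis
  proof eventually_elim
    fix x assume *: "\<forall>n. indicator (ball 0 (real (Suc n))) x * \<bar>u x\<bar> powr p = 0"
    obtain n where "norm x < real n" using reals_Archimedean2 by blast
    then have "x \<in> ball 0 (real (Suc n))" by simp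
    then show "u x = 0" using *[rule_format, of n] by simp
  qed
qed

text \<open>The increments, scaled by \<open>2 ^ k\<close>, still have summable masses on each ball.  Hence almost
  everywhere the scaled increments are bounded in \<open>k\<close>, and the increments themselves are summable.\<close>

lemma AE_convergent_if_rapidly_Cauchy:
  fixes u :: "nat \<Rightarrow> real ^ 'n \<Rightarrow> real"
  assumes mem: "\<And>k. u k \<in> ball_mass_functions p q b"
    and p: "1 \<le> p" and q: "1 \<le> q" and b: "0 \<le> b"
    and rapid: "\<And>k. modular p q b (\<lambda>x. u (Suc k) x - u k x) \<le> ((1/4) ^ k) powr (p * q)"
  shows "AE x in lebesgue. convergent (\<lambda>k. u k x)"
proof -
  define d where "d k x = 2 ^ k * (u (Suc k) x - u k x)" for k x
  have d: "d k \<in> ball_mass_functions p q b" for k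
    unfolding d_def by (intro ball_mass_functions_scale ball_mass_functions_diff p q mem)
  have md: "modular p q b (d k) \<le> ((1/2) ^ k) powr (p * q)" for k
  proof -
    have "modular p q b (d k) = (2 ^ k) powr (p * q) * modular p q b (\<lambda>x. u (Suc k) x - u k x)"
      unfolding d_def by (simp add: modular_scale)
    also have "\<dots> \<le> (2 ^ k) powr (p * q) * ((1/4) ^ k) powr (p * q)"
      by (intro mult_left_mono rapid) simp
    also have "\<dots> = (2 ^ k * (1/4) ^ k) powr (p * q)"
      by (rule powr_mult[symmetric])
    also have "(2::real) ^ k * (1/4) ^ k = (1/2) ^ k"
      by (simp add: power_mult_distrib[symmetric])
    finally show ?thesis .
  qed
  have ae: "AE x in lebesgue. x \<in> ball 0 R \<longrightarrow> convergent (\<lambda>k. u k x)" if R: "0 < R" for R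
  proof -
    define c where "c = ((R + 1) powr b) powr (1 / q)"
    define D where "D k x = ennreal (indicator (ball 0 R) x * \<bar>d k x\<bar> powr p)" for k x
    have Dm: "D k \<in> borel_measurable lebesgue" for k
      unfolding D_def
      using measurable_ball_powr[OF ball_mass_functions_measurable[OF d]] by simp
    have D: "(\<integral>\<^sup>+x. D k x \<partial>lebesgue) \<le> ennreal (c * (1/2) ^ k)" for k
    proof -
      have "mass p (d k) R \<le> (modular p q b (d k) * (R + 1) powr b) powr (1 / q)"
        using q by (intro mass_le_modular[OF d R b]) simp
      also have "\<dots> \<le> (((1/2) ^ k) powr (p * q) * (R + 1) powr b) powr (1 / q)"
        using q md by (intro powr_mono2 mult_right_mono) auto
      also have "\<dots> = ((1/2) ^ k) powr p * c"
        using q by (simp add: powr_mult powr_powr c_def)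
      also have "\<dots> \<le> (1/2) ^ k * c"
        using p powr_mono'[of 1 p "(1/2) ^ k :: real"]
        by (intro mult_right_mono) (auto simp: c_def power_le_one)
      finally have "ennreal (mass p (d k) R) \<le> ennreal (c * (1/2) ^ k)"
        by (simp add: mult.commute ennreal_leI)
      moreover have "(\<integral>\<^sup>+x. D k x \<partial>lebesgue) = ennreal (mass p (d k) R)"
        unfolding D_def mass_def using ball_mass_functions_locally_p_integrable[OF d]
        by (intro nn_integral_eq_integral) (auto simp: locally_p_integrable_def)
      ultimately show ?thesis by simp
    qed
    have "(\<integral>\<^sup>+x. (\<Sum>k. D k x) \<partial>lebesgue) = (\<Sum>k. \<integral>\<^sup>+x. D k x \<partial>lebesgue)"
      by (intro nn_integral_suminf Dm)
    also have "\<dots> \<le> (\<Sum>k. ennreal (c * (1/2) ^ k))"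
      by (intro suminf_le D summableI)
    also have "\<dots> < \<infinity>"
      by (subst suminf_ennreal2) (auto simp: c_def intro!: summable_mult summable_geometric)
    finally have "(\<integral>\<^sup>+x. (\<Sum>k. D k x) \<partial>lebesgue) \<noteq> \<infinity>" by simp
    then have "AE x in lebesgue. (\<Sum>k. D k x) \<noteq> \<infinity>"
      using Dm by (intro nn_integral_PInf_AE) auto
    then show ?thesis
    proof eventually_elim
      fix x assume fin: "(\<Sum>k. D k x) \<noteq> \<infinity>"
      show "x \<in> ball 0 R \<longrightarrow> convergent (\<lambda>k. u k x)"
      proof
        assume x: "x \<in> ball 0 R"
        define B where "B = enn2real (\<Sum>k. D k x)"
        have "\<bar>d k x\<bar> powr p \<le> B" for k
        proof -
          have "D k x \<le> (\<Sum>k. D k x)"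
            using sum_le_suminf[of "\<lambda>k. D k x" "{k}"] by (simp add: summableI)
          also have "\<dots> = ennreal B"
            using fin by (simp add: B_def less_top)
          finally show ?thesis
            using x by (simp add: D_def B_def)
        qed
        then have "(\<bar>d k x\<bar> powr p) powr (1 / p) \<le> B powr (1 / p)" for k
          using p by (intro powr_mono2) auto
        then have bd: "2 ^ k * \<bar>u (Suc k) x - u k x\<bar> \<le> B powr (1 / p)" for k
          using p by (simp add: powr_powr d_def abs_mult)
        have "summable (\<lambda>k. u (Suc k) x - u k x)"
        proof (rule summable_comparison_test)
          show "\<exists>N. \<forall>k\<ge>N. norm (u (Suc k) x - u k x) \<le> B powr (1 / p) * (1/2) ^ k"
            using bd by (auto simp: power_divide field_simps abs_mult)
        qed (auto intro!: summable_mult summable_geometric)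
        then have "convergent (\<lambda>n. \<Sum>k<n. u (Suc k) x - u k x)"
          by (simp add: summable_iff_convergent)
        then have "convergent (\<lambda>n. u n x - u 0 x)"
          by (simp add: sum_lessThan_telescope[of "\<lambda>k. u k x"])
        from convergent_add[OF this convergent_const[of "u 0 x"]]
        show "convergent (\<lambda>k. u k x)" by simp
      qed
    qed
  qed
  have "AE x in lebesgue. \<forall>n. x \<in> ball 0 (real (Suc n)) \<longrightarrow> convergent (\<lambda>k. u k x)"
    unfolding AE_all_countable by (intro allI ae) simp
  then show ?thesis
  proof eventually_elim
    fix x :: "real ^ 'n"
    assume *: "\<forall>n. x \<in> ball 0 (real (Suc n)) \<longrightarrow> convergent (\<lambda>k. u k x)"
    obtain n where "norm x < real n" using reals_Archimedean2 by blast
    then show "convergent (\<lambda>k. u k x)" using *[rule_format, of n] by simp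
  qed
qed

lemma ball_mass_complete:
  fixes u :: "nat \<Rightarrow> real ^ 'n \<Rightarrow> real"
  assumes p: "1 \<le> p" and q: "1 \<le> q" and b: "0 \<le> b"
    and mem: "\<And>k. u k \<in> ball_mass_functions p q b"
    and Cauchy: "\<And>e. 0 < e \<Longrightarrow> \<exists>N. \<forall>m\<ge>N. \<forall>n\<ge>N. modular p q b (\<lambda>x. u m x - u n x) \<le> e"
  shows "\<exists>w\<in>ball_mass_functions p q b.
    \<forall>e>0. \<exists>N. \<forall>n\<ge>N. modular p q b (\<lambda>x. w x - u n x) \<le> e"
proof -
  have pq: "0 < p" "0 < q" using p q by auto
  have "\<forall>k. \<exists>N. \<forall>m\<ge>N. \<forall>n\<ge>N. modular p q b (\<lambda>x. u m x - u n x) \<le> ((1/4) ^ k) powr (p * q)"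
    by (intro allI Cauchy) simp
  then obtain N where N: "\<And>k m n. N k \<le> m \<Longrightarrow> N k \<le> n \<Longrightarrow>
      modular p q b (\<lambda>x. u m x - u n x) \<le> ((1/4) ^ k) powr (p * q)"
    by metis
  \<comment> \<open>Nondecreasing indices beyond both \<open>k\<close> and \<open>N k\<close>.\<close>
  define r where "r k = k + (\<Sum>i\<le>k. N i)" for k
  have r: "N k \<le> r k" "k \<le> r k" "r k \<le> r (Suc k)" for k
    using member_le_sum[of k "{..k}" N] by (auto simp: r_def)
  define w where "w x = lim (\<lambda>k. u (r k) x)" for x
  have "AE x in lebesgue. convergent (\<lambda>k. u (r k) x)"
  proof (rule AE_convergent_if_rapidly_Cauchy[OF mem p q b])
    fix k
    show "modular p q b (\<lambda>x. u (r (Suc k)) x - u (r k) x) \<le> ((1/4) ^ k) powr (p * q)"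
      using r[of k] by (intro N) auto
  qed
  then have lim: "AE x in lebesgue. (\<lambda>k. u (r k) x) \<longlonglongrightarrow> w x"
    by eventually_elim (simp add: w_def convergent_LIMSEQ_iff)
  have wm: "w \<in> borel_measurable lebesgue"
    unfolding w_def using mem[THEN ball_mass_functions_measurable] by (intro borel_measurable_lim_metric)
  have close: "ball_mass_integral p q b (\<lambda>x. w x - u n x) \<le> ennreal e"
    if M: "\<forall>m\<ge>M. \<forall>n\<ge>M. modular p q b (\<lambda>x. u m x - u n x) \<le> e" and n: "M \<le> n" for e M n
  proof -
    have dm: "(\<lambda>x. u (r (k + M)) x - u n x) \<in> ball_mass_functions p q b" for k
      using p q mem mem by (rule ball_mass_functions_diff)
    have "AE x in lebesgue. (\<lambda>k. u (r (k + M)) x - u n x) \<longlonglongrightarrow> w x - u n x"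
      using lim by eventually_elim (intro tendsto_diff tendsto_const, rule LIMSEQ_ignore_initial_segment)
    from ball_mass_integral_liminf[OF dm pq this]
    have "ball_mass_integral p q b (\<lambda>x. w x - u n x)
        \<le> liminf (\<lambda>k. ball_mass_integral p q b (\<lambda>x. u (r (k + M)) x - u n x))" .
    also have "\<dots> \<le> ennreal e"
    proof (rule Liminf_le)
      have "ball_mass_integral p q b (\<lambda>x. u (r (k + M)) x - u n x) \<le> ennreal e" for k
        unfolding ball_mass_integral_eq_modular[OF dm]
        using M n r(2)[of "k + M"] by (intro ennreal_leI) auto
      then show "\<forall>\<^sub>F k in sequentially. ball_mass_integral p q b (\<lambda>x. u (r (k + M)) x - u n x) \<le> ennreal e"
        by simp
    qed simp
    finally show ?thesis .
  qed
  have diff: "(\<lambda>x. w x - u n x) \<in> ball_mass_functions p q b"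
    if "ball_mass_integral p q b (\<lambda>x. w x - u n x) \<le> ennreal e" for n e
    using that wm ball_mass_functions_measurable[OF mem[of n]]
    by (auto simp: ball_mass_functions_def intro: le_less_trans)
  obtain M where M: "\<forall>m\<ge>M. \<forall>n\<ge>M. modular p q b (\<lambda>x. u m x - u n x) \<le> 1"
    using Cauchy[of 1] by auto
  have "(\<lambda>x. (w x - u M x) + u M x) \<in> ball_mass_functions p q b"
    using p q diff[OF close[OF M order_refl]] mem by (rule ball_mass_functions_add)
  then have "w \<in> ball_mass_functions p q b" by simp
  moreover have "\<exists>N. \<forall>n\<ge>N. modular p q b (\<lambda>x. w x - u n x) \<le> e" if e: "0 < e" for e
  proof -
    obtain M where M: "\<forall>m\<ge>M. \<forall>n\<ge>M. modular p q b (\<lambda>x. u m x - u n x) \<le> e"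
      using Cauchy[OF e] by auto
    have "modular p q b (\<lambda>x. w x - u n x) \<le> e" if "M \<le> n" for n
      using close[OF M that] ball_mass_integral_eq_modular[OF diff[OF close[OF M that]]] e by simp
    then show ?thesis by blast
  qed
  ultimately show ?thesis by blast
qed

section \<open>The norm of functions\<close>

lemma powr_le_tangent:
  fixes x s :: real
  assumes "0 \<le> x" "0 < s" "s \<le> 1"
  shows "x powr s \<le> 1 + s * (x - 1)"
proof (cases "x = 0")
  case False
  then have "x powr s * 1 powr (1 - s) \<le> s * x + (1 - s) * 1"
    using assms by (intro Youngs_inequality_0) auto
  then show ?thesis by (simp add: algebra_simps)
qed (use assms in auto)

lemma ball_mass_norm_nonneg: "0 \<le> ball_mass_norm p q b u"
  by (simp add: ball_mass_norm_def)

lemma modular_eq_norm_powr: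
  assumes "0 < p * q" "u \<in> ball_mass_functions p q b"
  shows "modular p q b u = ball_mass_norm p q b u powr (p * q)"
proof -
  have "p \<noteq> 0" "q \<noteq> 0" using assms(1) by auto
  then show ?thesis
    by (simp add: ball_mass_norm_eq_modular[OF assms(2)] powr_powr)
qed

lemma ball_mass_norm_le_iff:
  assumes "0 < p * q" "u \<in> ball_mass_functions p q b" "0 \<le> a"
  shows "ball_mass_norm p q b u \<le> a \<longleftrightarrow> modular p q b u \<le> a powr (p * q)"
  unfolding modular_eq_norm_powr[OF assms(1,2)]
  using assms powr_mono2[of "p * q" "ball_mass_norm p q b u" a]
    powr_less_mono2[of "p * q" a "ball_mass_norm p q b u"] ball_mass_norm_nonneg[of p q b u]
  by (auto simp: not_le[symmetric] dest: leI)

lemma ball_mass_norm_scale: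
  assumes pq: "0 < p * q" and u: "u \<in> ball_mass_functions p q b"
  shows "ball_mass_norm p q b (\<lambda>x. c * u x) = \<bar>c\<bar> * ball_mass_norm p q b u"
proof -
  have "p \<noteq> 0" "q \<noteq> 0" using pq by auto
  then show ?thesis
    by (simp add: ball_mass_norm_eq_modular[OF u] modular_scale powr_mult powr_powr
        ball_mass_norm_eq_modular[OF ball_mass_functions_scale[OF u]])
qed

text \<open>The convex modular is positively homogeneous of degree \<open>p * q\<close>, so the norm is the gauge of the
  convex set where the modular is at most \<open>1\<close>.\<close>

lemma ball_mass_norm_triangle:
  assumes p: "1 \<le> p" and q: "1 \<le> q"
    and u: "u \<in> ball_mass_functions p q b" and v: "v \<in> ball_mass_functions p q b"
  shows "ball_mass_norm p q b (\<lambda>x. u x + v x) \<le> ball_mass_norm p q b u + ball_mass_norm p q b v"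
proof (rule field_le_epsilon)
  fix e :: real assume e: "0 < e"
  have pq: "0 < p * q" using p q by simp
  \<comment> \<open>Adding \<open>e / 2\<close> makes both scaling factors nonzero.\<close>
  define a c where "a = ball_mass_norm p q b u + e / 2" and "c = ball_mass_norm p q b v + e / 2"
  have a: "0 < a" and c: "0 < c"
    using e ball_mass_norm_nonneg[of p q b u] ball_mass_norm_nonneg[of p q b v] by (auto simp: a_def c_def)
  have unit: "modular p q b (\<lambda>x. (1 / k) * z x) \<le> 1"
    if z: "z \<in> ball_mass_functions p q b" and k: "0 < k" "ball_mass_norm p q b z \<le> k" for z k
  proof -
    have "modular p q b z \<le> k powr (p * q)"
      using ball_mass_norm_le_iff[OF pq z] k by simp
    then show ?thesis
      using k unfolding modular_scale by (simp add: powr_divide divide_le_eq)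
  qed
  define t where "t = c / (a + c)"
  have t: "0 \<le> t" "t \<le> 1" using a c by (auto simp: t_def)
  have sum: "(\<lambda>x. u x + v x) \<in> ball_mass_functions p q b"
    using p q u v by (rule ball_mass_functions_add)
  have "(1 / (a + c)) * (u x + v x) = (1 - t) * ((1 / a) * u x) + t * ((1 / c) * v x)" for x
  proof -
    have "1 - t = a / (a + c)" using a c by (simp add: t_def field_simps)
    then show ?thesis using a c by (simp add: t_def add_divide_distrib)
  qed
  then have "modular p q b (\<lambda>x. (1 / (a + c)) * (u x + v x))
      = modular p q b (\<lambda>x. (1 - t) * ((1 / a) * u x) + t * ((1 / c) * v x))"
    by simp
  also have "\<dots> \<le> (1 - t) * modular p q b (\<lambda>x. (1 / a) * u x) + t * modular p q b (\<lambda>x. (1 / c) * v x)"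
    by (intro modular_convex p q t ball_mass_functions_scale u v)
  also have "\<dots> \<le> (1 - t) * 1 + t * 1"
    using t a c e by (intro add_mono mult_left_mono unit u v) (auto simp: a_def c_def)
  finally have "modular p q b (\<lambda>x. u x + v x) \<le> (a + c) powr (p * q)"
    using a c unfolding modular_scale by (simp add: powr_divide divide_le_eq)
  then have "ball_mass_norm p q b (\<lambda>x. u x + v x) \<le> a + c"
    using ball_mass_norm_le_iff[OF pq sum] a c by simp
  then show "ball_mass_norm p q b (\<lambda>x. u x + v x) \<le> ball_mass_norm p q b u + ball_mass_norm p q b v + e"
    by (simp add: a_def c_def)
qed

lemma ball_mass_norm_uniformly_convex:
  fixes p q b \<epsilon> :: real
  assumes p: "1 < p" and q: "1 \<le> q" and \<epsilon>: "0 < \<epsilon>"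
  obtains \<delta> where "0 < \<delta>"
    and "\<And>u v :: real ^ 'n \<Rightarrow> real. u \<in> ball_mass_functions p q b \<Longrightarrow> v \<in> ball_mass_functions p q b \<Longrightarrow>
      ball_mass_norm p q b u = 1 \<Longrightarrow> ball_mass_norm p q b v = 1 \<Longrightarrow>
      \<epsilon> \<le> ball_mass_norm p q b (\<lambda>x. u x - v x) \<Longrightarrow>
      ball_mass_norm p q b (\<lambda>x. 1 / 2 * (u x + v x)) \<le> 1 - \<delta>"
proof -
  have p1: "1 \<le> p" using p by simp
  have pq: "0 < p * q" "1 \<le> p * q"
    using p q mult_mono[of 1 p 1 q] by auto
  define \<eta> where "\<eta> = \<epsilon> powr (p * q)"
  have \<eta>: "0 < \<eta>" using \<epsilon> by (simp add: \<eta>_def)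
  have "0 < \<eta> / 4" using \<eta> by simp
  from modular_uniformly_convex[OF p q this, where 'n = 'n and b = b]
  obtain C where C: "0 < C"
    and uc: "\<And>u v :: real ^ 'n \<Rightarrow> real. u \<in> ball_mass_functions p q b \<Longrightarrow> v \<in> ball_mass_functions p q b \<Longrightarrow>
      modular p q b (\<lambda>x. u x - v x) \<le> \<eta> / 4 * (modular p q b u + modular p q b v)
        + C * ((modular p q b u + modular p q b v) / 2 - modular p q b (\<lambda>x. (u x + v x) / 2))"
    by blast
  show ?thesis
  proof (rule that)
    show "0 < \<eta> / (2 * C) / (p * q)" using \<eta> C pq by simp
    fix u v :: "real ^ 'n \<Rightarrow> real"
    assume u: "u \<in> ball_mass_functions p q b" and v: "v \<in> ball_mass_functions p q b"
      and nu: "ball_mass_norm p q b u = 1" and nv: "ball_mass_norm p q b v = 1"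
      and far: "\<epsilon> \<le> ball_mass_norm p q b (\<lambda>x. u x - v x)"
    define m where "m = (\<lambda>x. 1 / 2 * (u x + v x))"
    have m: "m \<in> ball_mass_functions p q b"
      unfolding m_def by (intro ball_mass_functions_scale ball_mass_functions_add p1 q u v)
    have "\<eta> \<le> modular p q b (\<lambda>x. u x - v x)"
      using powr_mono2[OF _ _ far, of "p * q"] pq \<epsilon>
        modular_eq_norm_powr[OF pq(1) ball_mass_functions_diff[OF p1 q u v]] by (simp add: \<eta>_def)
    also have "\<dots> \<le> \<eta> / 2 + C * (1 - modular p q b m)"
      using uc[OF u v] modular_eq_norm_powr[OF pq(1) u] modular_eq_norm_powr[OF pq(1) v] nu nv
      by (simp add: m_def)
    finally have "modular p q b m - 1 \<le> - (\<eta> / (2 * C))"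
      using C by (simp add: field_simps)
    then have "(1 / (p * q)) * (modular p q b m - 1) \<le> (1 / (p * q)) * (- (\<eta> / (2 * C)))"
      using pq by (intro mult_left_mono) auto
    moreover have "ball_mass_norm p q b m \<le> 1 + (1 / (p * q)) * (modular p q b m - 1)"
      unfolding ball_mass_norm_eq_modular[OF m] using pq by (intro powr_le_tangent) auto
    ultimately show "ball_mass_norm p q b (\<lambda>x. 1 / 2 * (u x + v x)) \<le> 1 - \<eta> / (2 * C) / (p * q)"
      by (simp add: m_def mult_ac)
  qed
qed

lemma ball_mass_norm_uniformly_smooth:
  fixes p q b \<epsilon> :: real
  assumes p: "1 < p" and q: "1 \<le> q" and \<epsilon>: "0 < \<epsilon>"
  obtains \<delta> where "0 < \<delta>"
    and "\<And>u v :: real ^ 'n \<Rightarrow> real. u \<in> ball_mass_functions p q b \<Longrightarrow> v \<in> ball_mass_functions p q b \<Longrightarrow>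
      ball_mass_norm p q b u = 1 \<Longrightarrow> ball_mass_norm p q b v \<le> \<delta> \<Longrightarrow>
      ball_mass_norm p q b (\<lambda>x. u x + v x) + ball_mass_norm p q b (\<lambda>x. u x - v x)
        \<le> 2 + \<epsilon> * ball_mass_norm p q b v"
proof -
  have p1: "1 \<le> p" using p by simp
  have pq: "0 < p * q" "1 \<le> p * q"
    using p q mult_mono[of 1 p 1 q] by auto
  have pos: "0 < \<epsilon> * (p * q) / 2" using \<epsilon> pq by simp
  show ?thesis
  proof (rule modular_uniformly_smooth[OF p q pos, where 'n = 'n and b = b])
    fix \<delta> assume \<delta>: "0 < \<delta>"
      and us: "\<And>\<tau> (u :: real ^ 'n \<Rightarrow> real) w. 0 < \<tau> \<Longrightarrow> \<tau> \<le> \<delta> \<Longrightarrow>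
        u \<in> ball_mass_functions p q b \<Longrightarrow> w \<in> ball_mass_functions p q b \<Longrightarrow>
        modular p q b (\<lambda>x. u x + \<tau> * w x) + modular p q b (\<lambda>x. u x - \<tau> * w x)
          \<le> 2 * modular p q b u + \<epsilon> * (p * q) / 2 * \<tau> * (modular p q b u + modular p q b w)"
    show ?thesis
    proof (rule that[OF \<delta>])
      fix u v :: "real ^ 'n \<Rightarrow> real"
      assume u: "u \<in> ball_mass_functions p q b" and v: "v \<in> ball_mass_functions p q b"
        and nu: "ball_mass_norm p q b u = 1" and nv: "ball_mass_norm p q b v \<le> \<delta>"
      have f: "(\<lambda>x. u x + v x) \<in> ball_mass_functions p q b"
        using p1 q u v by (rule ball_mass_functions_add)
      have g: "(\<lambda>x. u x - v x) \<in> ball_mass_functions p q b"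
        using p1 q u v by (rule ball_mass_functions_diff)
      define \<tau> where "\<tau> = ball_mass_norm p q b v"
      show "ball_mass_norm p q b (\<lambda>x. u x + v x) + ball_mass_norm p q b (\<lambda>x. u x - v x)
          \<le> 2 + \<epsilon> * ball_mass_norm p q b v"
      proof (cases "\<tau> = 0")
        case True
        have v': "(\<lambda>x. - 1 * v x) \<in> ball_mass_functions p q b"
          using v by (rule ball_mass_functions_scale)
        show ?thesis
          using ball_mass_norm_triangle[OF p1 q u v] ball_mass_norm_triangle[OF p1 q u v']
            ball_mass_norm_scale[OF pq(1) v, of "- 1"] nu True by (simp add: \<tau>_def)
      next
        case False
        then have \<tau>: "0 < \<tau>" "\<tau> \<le> \<delta>"
          using ball_mass_norm_nonneg[of p q b v] nv by (auto simp: \<tau>_def)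
        \<comment> \<open>Write \<open>v = \<tau> w\<close> with \<open>w\<close> of norm one.\<close>
        define w where "w = (\<lambda>x. 1 / \<tau> * v x)"
        have w: "w \<in> ball_mass_functions p q b"
          unfolding w_def using v by (rule ball_mass_functions_scale)
        have "ball_mass_norm p q b w = 1"
          unfolding w_def ball_mass_norm_scale[OF pq(1) v] using \<tau> by (simp add: \<tau>_def)
        then have one: "modular p q b u = 1" "modular p q b w = 1"
          using nu modular_eq_norm_powr[OF pq(1) u] modular_eq_norm_powr[OF pq(1) w] by auto
        have "modular p q b (\<lambda>x. u x + v x) + modular p q b (\<lambda>x. u x - v x) \<le> 2 + \<epsilon> * (p * q) * \<tau>"
          using us[OF \<tau> u w] one \<tau> by (simp add: w_def)
        then have "(1 / (p * q)) * (modular p q b (\<lambda>x. u x + v x) + modular p q b (\<lambda>x. u x - v x) - 2)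
            \<le> (1 / (p * q)) * (\<epsilon> * (p * q) * \<tau>)"
          using pq by (intro mult_left_mono) auto
        also have "\<dots> = \<epsilon> * \<tau>" using p q by simp
        finally have le: "(1 / (p * q)) * (modular p q b (\<lambda>x. u x + v x) - 1)
            + (1 / (p * q)) * (modular p q b (\<lambda>x. u x - v x) - 1) \<le> \<epsilon> * \<tau>"
          by (simp add: algebra_simps)
        have tangent: "ball_mass_norm p q b z \<le> 1 + (1 / (p * q)) * (modular p q b z - 1)"
          if "z \<in> ball_mass_functions p q b" for z
          unfolding ball_mass_norm_eq_modular[OF that] using pq by (intro powr_le_tangent) auto
        show ?thesis
          using tangent[OF f] tangent[OF g] le by (simp add: \<tau>_def)
      qed
    qed
  qed
qed

section \<open>The space of equivalence classes\<close>

lemma class_in_carrier: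
  "u \<in> ball_mass_functions p q b \<Longrightarrow> ae_eq `` {u} \<in> carrier (ball_mass_space p q b)"
  by (simp add: ball_mass_space_def quotientI)

lemma carrier_ball_mass_spaceE:
  assumes "A \<in> carrier (ball_mass_space p q b)"
  obtains u where "u \<in> ball_mass_functions p q b" "A = ae_eq `` {u}"
  using assms by (auto simp: ball_mass_space_def elim: quotientE)

lemma class_add:
  assumes "u \<in> ball_mass_functions p q b" "v \<in> ball_mass_functions p q b"
  shows "ae_eq `` {u} \<oplus>\<^bsub>ball_mass_space p q b\<^esub> ae_eq `` {v} = ae_eq `` {\<lambda>x. u x + v x}"
  using assms by (intro ball_mass_space_add ball_mass_functions_measurable)

lemma class_smult:
  assumes "u \<in> ball_mass_functions p q b"
  shows "c \<odot>\<^bsub>ball_mass_space p q b\<^esub> (ae_eq `` {u}) = ae_eq `` {\<lambda>x. c * u x}"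
  using assms by (intro ball_mass_space_smult ball_mass_functions_measurable)

lemma class_norm:
  assumes "u \<in> ball_mass_functions p q b"
  shows "ball_mass_space_norm p q b (ae_eq `` {u}) = ball_mass_norm p q b u"
  using assms by (intro ball_mass_space_norm ball_mass_functions_measurable)

lemma zero_ball_mass_space: "\<zero>\<^bsub>ball_mass_space p q b\<^esub> = ae_eq `` {\<lambda>x. 0}"
  by (simp add: ball_mass_space_def)

lemma abelian_group_ball_mass_space:
  assumes p: "1 \<le> p" and q: "1 \<le> q"
  shows "abelian_group (ball_mass_space p q b :: (real, (real ^ 'n \<Rightarrow> real) set) module)"
proof (rule abelian_groupI)
  let ?V = "ball_mass_space p q b :: (real, (real ^ 'n \<Rightarrow> real) set) module"
  note add = ball_mass_functions_add[OF p q]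
  show "\<zero>\<^bsub>?V\<^esub> \<in> carrier ?V"
    by (simp add: zero_ball_mass_space class_in_carrier ball_mass_functions_zero)
  fix A assume "A \<in> carrier ?V"
  then obtain u where u: "u \<in> ball_mass_functions p q b" "A = ae_eq `` {u}"
    by (rule carrier_ball_mass_spaceE)
  show "\<zero>\<^bsub>?V\<^esub> \<oplus>\<^bsub>?V\<^esub> A = A"
    using u class_add[OF ball_mass_functions_zero u(1)] by (simp add: zero_ball_mass_space)
  show "\<exists>B\<in>carrier ?V. B \<oplus>\<^bsub>?V\<^esub> A = \<zero>\<^bsub>?V\<^esub>"
    using u class_add[OF ball_mass_functions_scale[OF u(1), of "-1"] u(1)]
    by (intro bexI[OF _ class_in_carrier[OF ball_mass_functions_scale[OF u(1), of "-1"]]])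
      (simp add: zero_ball_mass_space)
  fix B assume "B \<in> carrier ?V"
  then obtain v where v: "v \<in> ball_mass_functions p q b" "B = ae_eq `` {v}"
    by (rule carrier_ball_mass_spaceE)
  show "A \<oplus>\<^bsub>?V\<^esub> B \<in> carrier ?V"
    using u v by (simp add: class_add class_in_carrier add)
  show "A \<oplus>\<^bsub>?V\<^esub> B = B \<oplus>\<^bsub>?V\<^esub> A"
    using u v by (simp add: class_add add.commute)
  fix C assume "C \<in> carrier ?V"
  then obtain w where w: "w \<in> ball_mass_functions p q b" "C = ae_eq `` {w}"
    by (rule carrier_ball_mass_spaceE)
  show "(A \<oplus>\<^bsub>?V\<^esub> B) \<oplus>\<^bsub>?V\<^esub> C = A \<oplus>\<^bsub>?V\<^esub> (B \<oplus>\<^bsub>?V\<^esub> C)"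
    using u v w by (simp add: class_add add add.assoc)
qed

lemma module_ball_mass_space:
  assumes p: "1 \<le> p" and q: "1 \<le> q"
  shows "module real_ring (ball_mass_space p q b :: (real, (real ^ 'n \<Rightarrow> real) set) module)"
proof (rule moduleI[OF cring_real_ring abelian_group_ball_mass_space[OF p q]])
  let ?V = "ball_mass_space p q b :: (real, (real ^ 'n \<Rightarrow> real) set) module"
  fix a c :: real and A assume "A \<in> carrier ?V"
  then obtain u where u: "u \<in> ball_mass_functions p q b" "A = ae_eq `` {u}"
    by (rule carrier_ball_mass_spaceE)
  note scale = ball_mass_functions_scale
  show "a \<odot>\<^bsub>?V\<^esub> A \<in> carrier ?V"
    using u by (simp add: class_smult class_in_carrier scale)
  show "(a \<oplus>\<^bsub>real_ring\<^esub> c) \<odot>\<^bsub>?V\<^esub> A = a \<odot>\<^bsub>?V\<^esub> A \<oplus>\<^bsub>?V\<^esub> c \<odot>\<^bsub>?V\<^esub> A"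
    using u by (simp add: class_smult class_add scale distrib_right)
  show "(a \<otimes>\<^bsub>real_ring\<^esub> c) \<odot>\<^bsub>?V\<^esub> A = a \<odot>\<^bsub>?V\<^esub> (c \<odot>\<^bsub>?V\<^esub> A)"
    using u by (simp add: class_smult scale mult.assoc)
  show "\<one>\<^bsub>real_ring\<^esub> \<odot>\<^bsub>?V\<^esub> A = A"
    using u by (simp add: class_smult)
  fix B assume "B \<in> carrier ?V"
  then obtain v where v: "v \<in> ball_mass_functions p q b" "B = ae_eq `` {v}"
    by (rule carrier_ball_mass_spaceE)
  show "a \<odot>\<^bsub>?V\<^esub> (A \<oplus>\<^bsub>?V\<^esub> B) = a \<odot>\<^bsub>?V\<^esub> A \<oplus>\<^bsub>?V\<^esub> a \<odot>\<^bsub>?V\<^esub> B"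
    using u v by (simp add: class_smult class_add scale ball_mass_functions_add[OF p q] distrib_left)
qed

lemma class_minus:
  fixes u v :: "real ^ 'n \<Rightarrow> real"
  assumes p: "1 \<le> p" and q: "1 \<le> q"
    and u: "u \<in> ball_mass_functions p q b" and v: "v \<in> ball_mass_functions p q b"
  shows "ae_eq `` {u} \<ominus>\<^bsub>ball_mass_space p q b\<^esub> ae_eq `` {v} = ae_eq `` {\<lambda>x. u x - v x}"
proof -
  interpret V: abelian_group "ball_mass_space p q b :: (real, (real ^ 'n \<Rightarrow> real) set) module"
    using p q by (rule abelian_group_ball_mass_space)
  have v': "(\<lambda>x. - 1 * v x) \<in> ball_mass_functions p q b"
    using v by (rule ball_mass_functions_scale)
  have "\<ominus>\<^bsub>ball_mass_space p q b\<^esub> (ae_eq `` {v}) = ae_eq `` {\<lambda>x. - 1 * v x}"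
    using class_add[OF v' v] class_in_carrier[OF v] class_in_carrier[OF v']
    by (intro V.minus_equality) (auto simp: zero_ball_mass_space)
  then show ?thesis
    using class_add[OF u v'] by (simp add: V.minus_eq)
qed

lemma real_normed_space_ball_mass_space:
  assumes p: "1 \<le> p" and q: "1 \<le> q" and b: "0 \<le> b"
  shows "real_normed_space (ball_mass_space p q b :: (real, (real ^ 'n \<Rightarrow> real) set) module)
    (ball_mass_space_norm p q b)"
proof (intro real_normed_space.intro real_normed_space_axioms.intro module_ball_mass_space p q)
  let ?V = "ball_mass_space p q b :: (real, (real ^ 'n \<Rightarrow> real) set) module"
  have pq: "0 < p * q" using p q by simp
  fix A assume "A \<in> carrier ?V"
  then obtain u where u: "u \<in> ball_mass_functions p q b" "A = ae_eq `` {u}"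
    by (rule carrier_ball_mass_spaceE)
  show "0 \<le> ball_mass_space_norm p q b A"
    using u by (simp add: class_norm ball_mass_norm_nonneg)
  show "ball_mass_space_norm p q b A = 0 \<longleftrightarrow> A = \<zero>\<^bsub>?V\<^esub>"
  proof
    assume "ball_mass_space_norm p q b A = 0"
    then have "modular p q b u = 0"
      using u modular_eq_norm_powr[OF pq u(1)] by (simp add: class_norm)
    then have "AE x in lebesgue. u x = 0"
      using q by (intro AE_zero_if_modular_zero[OF u(1) b]) auto
    then have "(u, \<lambda>x. 0) \<in> ae_eq"
      using ball_mass_functions_measurable[OF u(1)] by (simp add: ae_eq_def)
    then show "A = \<zero>\<^bsub>?V\<^esub>"
      unfolding u(2) zero_ball_mass_space by (rule equiv_class_eq[OF equiv_ae_eq])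
  next
    assume "A = \<zero>\<^bsub>?V\<^esub>"
    then show "ball_mass_space_norm p q b A = 0"
      using ball_mass_norm_scale[OF pq ball_mass_functions_zero[of p q b], of 0]
      by (simp add: zero_ball_mass_space class_norm ball_mass_functions_zero)
  qed
  show "ball_mass_space_norm p q b (a \<odot>\<^bsub>?V\<^esub> A) = \<bar>a\<bar> * ball_mass_space_norm p q b A" for a
    using u pq by (simp add: class_smult class_norm ball_mass_norm_scale ball_mass_functions_scale)
  fix B assume "B \<in> carrier ?V"
  then obtain v where v: "v \<in> ball_mass_functions p q b" "B = ae_eq `` {v}"
    by (rule carrier_ball_mass_spaceE)
  show "ball_mass_space_norm p q b (A \<oplus>\<^bsub>?V\<^esub> B) \<le> ball_mass_space_norm p q b A + ball_mass_space_norm p q b B"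
    using u v ball_mass_norm_triangle[OF p q u(1) v(1)]
    by (simp add: class_add class_norm ball_mass_functions_add[OF p q])
qed

lemma real_banach_space_ball_mass_space:
  assumes p: "1 \<le> p" and q: "1 \<le> q" and b: "0 \<le> b"
  shows "real_banach_space (ball_mass_space p q b :: (real, (real ^ 'n \<Rightarrow> real) set) module)
    (ball_mass_space_norm p q b)"
proof (intro real_banach_space.intro real_banach_space_axioms.intro real_normed_space_ball_mass_space p q b)
  let ?V = "ball_mass_space p q b :: (real, (real ^ 'n \<Rightarrow> real) set) module"
  let ?d = "norm_dist ?V (ball_mass_space_norm p q b)"
  have pq: "0 < p * q" using p q by simp
  interpret M: Metric_space "carrier ?V" ?d
    using p q b
    by (intro real_normed_space.Metric_space_norm_dist real_normed_space_ball_mass_space)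
  have dist: "?d (ae_eq `` {u}) (ae_eq `` {v}) = ball_mass_norm p q b (\<lambda>x. u x - v x)"
    if "u \<in> ball_mass_functions p q b" "v \<in> ball_mass_functions p q b" for u v
    using that by (simp add: norm_dist_def class_in_carrier class_minus[OF p q] class_norm
        ball_mass_functions_diff[OF p q])
  show "M.mcomplete"
    unfolding M.mcomplete_def
  proof (intro allI impI)
    fix \<sigma> assume \<sigma>: "M.MCauchy \<sigma>"
    have "\<exists>u. u \<in> ball_mass_functions p q b \<and> \<sigma> k = ae_eq `` {u}" for k
    proof -
      have "\<sigma> k \<in> carrier ?V" using \<sigma> by (auto simp: M.MCauchy_def)
      then show ?thesis by (rule carrier_ball_mass_spaceE) blast
    qed
    then obtain u where u: "\<And>k. u k \<in> ball_mass_functions p q b" "\<And>k. \<sigma> k = ae_eq `` {u k}"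
      by metis
    have "\<exists>w\<in>ball_mass_functions p q b. \<forall>e>0. \<exists>N. \<forall>n\<ge>N. modular p q b (\<lambda>x. w x - u n x) \<le> e"
    proof (rule ball_mass_complete[OF p q b u(1)])
      fix e :: real assume "0 < e"
      then have "0 < e powr (1 / (p * q))" by simp
      then obtain N where N: "\<And>m n. N \<le> m \<Longrightarrow> N \<le> n \<Longrightarrow> ?d (\<sigma> m) (\<sigma> n) < e powr (1 / (p * q))"
        using \<sigma> unfolding M.MCauchy_def by blast
      have "modular p q b (\<lambda>x. u m x - u n x) \<le> e" if mn: "N \<le> m" "N \<le> n" for m n
      proof -
        have "ball_mass_norm p q b (\<lambda>x. u m x - u n x) \<le> e powr (1 / (p * q))"
          using N[OF mn] by (simp add: u(2) dist u(1) less_imp_le)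
        then show ?thesis
          using p q pq \<open>0 < e\<close> ball_mass_functions_diff[OF p q u(1) u(1)]
          by (auto simp: ball_mass_norm_le_iff powr_powr)
      qed
      then show "\<exists>N. \<forall>m\<ge>N. \<forall>n\<ge>N. modular p q b (\<lambda>x. u m x - u n x) \<le> e" by blast
    qed
    then obtain w where w: "w \<in> ball_mass_functions p q b"
      and lim: "\<And>e. 0 < e \<Longrightarrow> \<exists>N. \<forall>n\<ge>N. modular p q b (\<lambda>x. w x - u n x) \<le> e"
      by blast
    have "limitin M.mtopology \<sigma> (ae_eq `` {w}) sequentially"
      unfolding M.limitin_metric
    proof (intro conjI allI impI)
      show "ae_eq `` {w} \<in> carrier ?V" using w by (rule class_in_carrier)
      fix e :: real assume e: "0 < e"
      then have "0 < (e / 2) powr (p * q)" by simp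
      then obtain N where N: "\<And>n. N \<le> n \<Longrightarrow> modular p q b (\<lambda>x. w x - u n x) \<le> (e / 2) powr (p * q)"
        using lim by blast
      have "\<sigma> n \<in> carrier ?V \<and> ?d (\<sigma> n) (ae_eq `` {w}) < e" if n: "N \<le> n" for n
      proof
        show "\<sigma> n \<in> carrier ?V" using u by (simp add: class_in_carrier)
        have "ball_mass_norm p q b (\<lambda>x. w x - u n x) \<le> e / 2"
          using N[OF n] e ball_mass_norm_le_iff[OF pq ball_mass_functions_diff[OF p q w u(1)], of "e / 2" n]
          by simp
        then have "?d (ae_eq `` {w}) (\<sigma> n) < e"
          using e by (simp add: u(2) dist w u(1))
        then show "?d (\<sigma> n) (ae_eq `` {w}) < e"
          by (simp add: M.commute)
      qed
      then show "\<forall>\<^sub>F n in sequentially. \<sigma> n \<in> carrier ?V \<and> ?d (\<sigma> n) (ae_eq `` {w}) < e"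
        by (auto simp: eventually_sequentially)
    qed
    then show "\<exists>x. limitin M.mtopology \<sigma> x sequentially" by blast
  qed
qed

lemma uniformly_convex_ball_mass_space:
  assumes p: "1 < p" and q: "1 \<le> q"
  shows "uniformly_convex (ball_mass_space p q b :: (real, (real ^ 'n \<Rightarrow> real) set) module)
    (ball_mass_space_norm p q b)"
  unfolding uniformly_convex_def
proof (intro allI impI)
  let ?V = "ball_mass_space p q b :: (real, (real ^ 'n \<Rightarrow> real) set) module"
  let ?N = "ball_mass_space_norm p q b"
  fix \<epsilon> :: real assume "0 < \<epsilon> \<and> \<epsilon> \<le> 2"
  then have \<epsilon>: "0 < \<epsilon>" by simp
  have p1: "1 \<le> p" using p by simp
  from ball_mass_norm_uniformly_convex[OF p q \<epsilon>, where 'n = 'n and b = b]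
  obtain \<delta> where \<delta>: "0 < \<delta>"
    and uc: "\<And>u v :: real ^ 'n \<Rightarrow> real. u \<in> ball_mass_functions p q b \<Longrightarrow> v \<in> ball_mass_functions p q b \<Longrightarrow>
      ball_mass_norm p q b u = 1 \<Longrightarrow> ball_mass_norm p q b v = 1 \<Longrightarrow>
      \<epsilon> \<le> ball_mass_norm p q b (\<lambda>x. u x - v x) \<Longrightarrow>
      ball_mass_norm p q b (\<lambda>x. 1 / 2 * (u x + v x)) \<le> 1 - \<delta>"
    by blast
  have "?N ((1 / 2) \<odot>\<^bsub>?V\<^esub> (A \<oplus>\<^bsub>?V\<^esub> B)) \<le> 1 - \<delta>"
    if A: "A \<in> carrier ?V" and B: "B \<in> carrier ?V"
      and n: "?N A = 1 \<and> ?N B = 1 \<and> \<epsilon> \<le> ?N (A \<ominus>\<^bsub>?V\<^esub> B)" for A B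
  proof -
    from A obtain u where u: "u \<in> ball_mass_functions p q b" "A = ae_eq `` {u}"
      by (rule carrier_ball_mass_spaceE)
    from B obtain v where v: "v \<in> ball_mass_functions p q b" "B = ae_eq `` {v}"
      by (rule carrier_ball_mass_spaceE)
    note mem = u(1) v(1) ball_mass_functions_add[OF p1 q] ball_mass_functions_diff[OF p1 q]
      ball_mass_functions_scale
    show ?thesis
      using uc[OF u(1) v(1)] n unfolding u(2) v(2)
      by (simp only: class_add class_smult class_minus[OF p1 q] class_norm mem)
  qed
  then show "\<exists>\<delta>>0. \<forall>A\<in>carrier ?V. \<forall>B\<in>carrier ?V. ?N A = 1 \<and> ?N B = 1 \<and> ?N (A \<ominus>\<^bsub>?V\<^esub> B) \<ge> \<epsilon> \<longrightarrow>
      ?N ((1 / 2) \<odot>\<^bsub>?V\<^esub> (A \<oplus>\<^bsub>?V\<^esub> B)) \<le> 1 - \<delta>"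
    using \<delta> by blast
qed

lemma uniformly_smooth_ball_mass_space:
  assumes p: "1 < p" and q: "1 \<le> q"
  shows "uniformly_smooth (ball_mass_space p q b :: (real, (real ^ 'n \<Rightarrow> real) set) module)
    (ball_mass_space_norm p q b)"
  unfolding uniformly_smooth_def
proof (intro allI impI)
  let ?V = "ball_mass_space p q b :: (real, (real ^ 'n \<Rightarrow> real) set) module"
  let ?N = "ball_mass_space_norm p q b"
  fix \<epsilon> :: real assume \<epsilon>: "0 < \<epsilon>"
  have p1: "1 \<le> p" using p by simp
  from ball_mass_norm_uniformly_smooth[OF p q \<epsilon>, where 'n = 'n and b = b]
  obtain \<delta> where \<delta>: "0 < \<delta>"
    and us: "\<And>u v :: real ^ 'n \<Rightarrow> real. u \<in> ball_mass_functions p q b \<Longrightarrow> v \<in> ball_mass_functions p q b \<Longrightarrow>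
      ball_mass_norm p q b u = 1 \<Longrightarrow> ball_mass_norm p q b v \<le> \<delta> \<Longrightarrow>
      ball_mass_norm p q b (\<lambda>x. u x + v x) + ball_mass_norm p q b (\<lambda>x. u x - v x)
        \<le> 2 + \<epsilon> * ball_mass_norm p q b v"
    by blast
  have "?N (A \<oplus>\<^bsub>?V\<^esub> B) + ?N (A \<ominus>\<^bsub>?V\<^esub> B) \<le> 2 + \<epsilon> * ?N B"
    if A: "A \<in> carrier ?V" and B: "B \<in> carrier ?V" and n: "?N A = 1 \<and> ?N B \<le> \<delta>" for A B
  proof -
    from A obtain u where u: "u \<in> ball_mass_functions p q b" "A = ae_eq `` {u}"
      by (rule carrier_ball_mass_spaceE)
    from B obtain v where v: "v \<in> ball_mass_functions p q b" "B = ae_eq `` {v}"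
      by (rule carrier_ball_mass_spaceE)
    note mem = u(1) v(1) ball_mass_functions_add[OF p1 q] ball_mass_functions_diff[OF p1 q]
    show ?thesis
      using us[OF u(1) v(1)] n unfolding u(2) v(2)
      by (simp only: class_add class_minus[OF p1 q] class_norm mem)
  qed
  then show "\<exists>\<delta>>0. \<forall>A\<in>carrier ?V. \<forall>B\<in>carrier ?V. ?N A = 1 \<and> ?N B \<le> \<delta> \<longrightarrow>
      ?N (A \<oplus>\<^bsub>?V\<^esub> B) + ?N (A \<ominus>\<^bsub>?V\<^esub> B) \<le> 2 + \<epsilon> * ?N B"
    using \<delta> by blast
qed

theorem theorem2p1:
  fixes p q b :: real
  assumes "2 \<le> CARD('n::finite)"
    and "1 < p" and "1 \<le> q" and "1 < b" and "b < 1 + real CARD('n) * q"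
  shows "real_banach_space (ball_mass_space p q b :: (real, (real ^ 'n \<Rightarrow> real) set) module)
           (ball_mass_space_norm p q b)
       \<and> uniformly_convex (ball_mass_space p q b :: (real, (real ^ 'n \<Rightarrow> real) set) module)
           (ball_mass_space_norm p q b)
       \<and> uniformly_smooth (ball_mass_space p q b :: (real, (real ^ 'n \<Rightarrow> real) set) module)
           (ball_mass_space_norm p q b)"
  using assms
  by (intro conjI real_banach_space_ball_mass_space uniformly_convex_ball_mass_space
      uniformly_smooth_ball_mass_space) auto

end
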